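(* Let $k$ be a nonzero commutative ring, let $\mathcal{A}$ be an essentially small additive category, and let $A : \mathcal{A}\to\mathbf{Ab}$ be a $k$-trivial additive functor. Then there exists an isomorphism $k[A]\simeq k^{A^\sharp}$ in the category $\mathcal{F}(\mathcal{A};k)$.
   Context: $\mathbf{Ab}$ is the category of abelian groups. $\mathcal{F}(\mathcal{A};k)$ is the category of (not necessarily additive) functors from $\mathcal{A}$ to $k$-modules, with natural transformations as morphisms. An additive functor $A : \mathcal{A}\to\mathbf{Ab}$ is called $k$-trivial if $A(x)$ is a finite abelian group for every object $x$ and the functor $x\mapsto k\otimes_{\mathbb{Z}}A(x)$ is zero. For a set $E$, $k[E]$ is the free $k$-module on $E$ (covariant in $E$) and $k^E$ is the $k$-module of all set functions $E\to k$ (contravariant in $E$). $k[A]$ denotes the functor $x\mapsto k[A(x)]$ (underlying set of $A(x)$). For a finite abelian group $V$, $V^\sharp:=\mathrm{Hom}_{\mathbb{Z}}(V,\mathbb{Q}/\mathbb{Z})$; for $A$ with finite values, $A^\sharp : \mathcal{A}^{\mathrm{op}}\to\mathbf{Ab}$ is $x\mapsto A(x)^\sharp$, and $k^{A^\sharp}$ is the (covariant) functor $x\mapsto k^{A(x)^\sharp}$ in $\mathcal{F}(\mathcal{A};k)$. *)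

theory Defs
  imports "HOL-Algebra.Algebra"
begin

section \<open>Additive categories\<close>

text \<open>
  The objects and the arrows of a category form sets in arbitrary types, so every category
  considered here is small (up to replacing an essentially small category by an equivalent small
  one, which does not change functor categories on it).  Each arrow determines its domain and its
  codomain.  Operations are only meaningful on composable, respectively parallel, arrows.
\<close>

record ('o, 'm) cat =
  Ob :: "'o set"
  Arr :: "'m set"
  Dom :: "'m \<Rightarrow> 'o"
  Cod :: "'m \<Rightarrow> 'o"
  Ident :: "'o \<Rightarrow> 'm"
  Comp :: "'m \<Rightarrow> 'm \<Rightarrow> 'm"

definition Hom :: "('o, 'm, 'z) cat_scheme \<Rightarrow> 'o \<Rightarrow> 'o \<Rightarrow> 'm set"
  where "Hom C x y = {f \<in> Arr C. Dom C f = x \<and> Cod C f = y}"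

locale category =
  fixes C :: "('o, 'm, 'z) cat_scheme"
  assumes Dom_closed: "f \<in> Arr C \<Longrightarrow> Dom C f \<in> Ob C"
    and Cod_closed: "f \<in> Arr C \<Longrightarrow> Cod C f \<in> Ob C"
    and Ident_closed: "x \<in> Ob C \<Longrightarrow> Ident C x \<in> Hom C x x"
    and Comp_closed: "\<lbrakk>f \<in> Hom C x y; g \<in> Hom C y z\<rbrakk> \<Longrightarrow> Comp C g f \<in> Hom C x z"
    and Comp_assoc: "\<lbrakk>f \<in> Hom C w x; g \<in> Hom C x y; h \<in> Hom C y z\<rbrakk>
      \<Longrightarrow> Comp C h (Comp C g f) = Comp C (Comp C h g) f"
    and Comp_Ident_right: "f \<in> Hom C x y \<Longrightarrow> Comp C f (Ident C x) = f"
    and Comp_Ident_left: "f \<in> Hom C x y \<Longrightarrow> Comp C (Ident C y) f = f"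

record ('o, 'm) preadd_cat = "('o, 'm) cat" +
  Add :: "'m \<Rightarrow> 'm \<Rightarrow> 'm"
  Zero :: "'o \<Rightarrow> 'o \<Rightarrow> 'm"

definition Hom_group :: "('o, 'm, 'z) preadd_cat_scheme \<Rightarrow> 'o \<Rightarrow> 'o \<Rightarrow> 'm monoid"
  where "Hom_group C x y = \<lparr>carrier = Hom C x y, monoid.mult = Add C, one = Zero C x y\<rparr>"

locale preadditive_category = category C for C :: "('o, 'm, 'z) preadd_cat_scheme" +
  assumes Hom_group: "\<lbrakk>x \<in> Ob C; y \<in> Ob C\<rbrakk> \<Longrightarrow> comm_group (Hom_group C x y)"
    and Comp_Add_right: "\<lbrakk>f \<in> Hom C x y; f' \<in> Hom C x y; g \<in> Hom C y z\<rbrakk>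
      \<Longrightarrow> Comp C g (Add C f f') = Add C (Comp C g f) (Comp C g f')"
    and Comp_Add_left: "\<lbrakk>f \<in> Hom C x y; g \<in> Hom C y z; g' \<in> Hom C y z\<rbrakk>
      \<Longrightarrow> Comp C (Add C g g') f = Add C (Comp C g f) (Comp C g' f)"

definition zero_object :: "('o, 'm, 'z) cat_scheme \<Rightarrow> 'o \<Rightarrow> bool"
  where "zero_object C z \<longleftrightarrow> z \<in> Ob C \<and>
    (\<forall>x\<in>Ob C. (\<exists>!f. f \<in> Hom C z x) \<and> (\<exists>!f. f \<in> Hom C x z))"

definition biproduct ::
    "('o, 'm, 'z) preadd_cat_scheme \<Rightarrow> 'o \<Rightarrow> 'o \<Rightarrow> 'o \<Rightarrow> 'm \<Rightarrow> 'm \<Rightarrow> 'm \<Rightarrow> 'm \<Rightarrow> bool"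
  where "biproduct C x y s i j p q \<longleftrightarrow>
    s \<in> Ob C \<and> i \<in> Hom C x s \<and> j \<in> Hom C y s \<and> p \<in> Hom C s x \<and> q \<in> Hom C s y \<and>
    Comp C p i = Ident C x \<and> Comp C q j = Ident C y \<and>
    Comp C q i = Zero C x y \<and> Comp C p j = Zero C y x \<and>
    Add C (Comp C i p) (Comp C j q) = Ident C s"

locale additive_category = preadditive_category +
  assumes ex_zero_object: "\<exists>z. zero_object C z"
    and ex_biproduct: "\<lbrakk>x \<in> Ob C; y \<in> Ob C\<rbrakk> \<Longrightarrow> \<exists>s i j p q. biproduct C x y s i j p q"


section \<open>Functors to abelian groups and to modules\<close>

text \<open>
  A functor to a category of structured sets: \<open>on_ob\<close> gives the structures and \<open>on_arr\<close> the
  underlying maps, which are only relevant on the carrier of the source.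
\<close>

record ('o, 'm, 's, 'v) concrete_functor =
  on_ob :: "'o \<Rightarrow> 's"
  on_arr :: "'m \<Rightarrow> 'v \<Rightarrow> 'v"

text \<open>Abelian groups are written multiplicatively, as usual for \<open>comm_group\<close>.\<close>

locale ab_functor = category C
  for C :: "('o, 'm, 'z) cat_scheme" and A :: "('o, 'm, 'a monoid, 'a) concrete_functor" +
  assumes ob_comm_group: "x \<in> Ob C \<Longrightarrow> comm_group (on_ob A x)"
    and arr_hom: "f \<in> Hom C x y \<Longrightarrow> on_arr A f \<in> hom (on_ob A x) (on_ob A y)"
    and arr_Ident: "\<lbrakk>x \<in> Ob C; v \<in> carrier (on_ob A x)\<rbrakk> \<Longrightarrow> on_arr A (Ident C x) v = v"
    and arr_Comp: "\<lbrakk>f \<in> Hom C x y; g \<in> Hom C y z; v \<in> carrier (on_ob A x)\<rbrakk>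
      \<Longrightarrow> on_arr A (Comp C g f) v = on_arr A g (on_arr A f v)"

locale additive_functor = preadditive_category C + ab_functor C A
  for C :: "('o, 'm, 'z) preadd_cat_scheme" and A :: "('o, 'm, 'a monoid, 'a) concrete_functor" +
  assumes arr_Add: "\<lbrakk>f \<in> Hom C x y; g \<in> Hom C x y; v \<in> carrier (on_ob A x)\<rbrakk>
    \<Longrightarrow> on_arr A (Add C f g) v = on_arr A f v \<otimes>\<^bsub>on_ob A y\<^esub> on_arr A g v"

definition mod_hom ::
    "('k, 'r) ring_scheme \<Rightarrow> ('k, 'v) module \<Rightarrow> ('k, 'w) module \<Rightarrow> ('v \<Rightarrow> 'w) set"
  where "mod_hom k M N = {h \<in> carrier M \<rightarrow> carrier N.
    (\<forall>u\<in>carrier M. \<forall>v\<in>carrier M. h (u \<oplus>\<^bsub>M\<^esub> v) = h u \<oplus>\<^bsub>N\<^esub> h v) \<and>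
    (\<forall>c\<in>carrier k. \<forall>u\<in>carrier M. h (c \<odot>\<^bsub>M\<^esub> u) = c \<odot>\<^bsub>N\<^esub> h u)}"

text \<open>The objects of \<open>\<F>(C;k)\<close>; no additivity is required.\<close>

locale module_functor = category C
  for k :: "('k, 'r) ring_scheme" and C :: "('o, 'm, 'z) cat_scheme"
    and F :: "('o, 'm, ('k, 'v) module, 'v) concrete_functor" +
  assumes ob_module: "x \<in> Ob C \<Longrightarrow> module k (on_ob F x)"
    and arr_mod_hom: "f \<in> Hom C x y \<Longrightarrow> on_arr F f \<in> mod_hom k (on_ob F x) (on_ob F y)"
    and arr_Ident: "\<lbrakk>x \<in> Ob C; u \<in> carrier (on_ob F x)\<rbrakk> \<Longrightarrow> on_arr F (Ident C x) u = u"
    and arr_Comp: "\<lbrakk>f \<in> Hom C x y; g \<in> Hom C y z; u \<in> carrier (on_ob F x)\<rbrakk>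
      \<Longrightarrow> on_arr F (Comp C g f) u = on_arr F g (on_arr F f u)"

text \<open>
  The two functors may take values in modules over different element types, so that \<open>k[A]\<close> and
  \<open>k^(A^#)\<close> can be compared.
\<close>

definition natural_transformation ::
    "('k, 'r) ring_scheme \<Rightarrow> ('o, 'm, 'z) cat_scheme \<Rightarrow> ('o, 'm, ('k, 'v) module, 'v) concrete_functor
      \<Rightarrow> ('o, 'm, ('k, 'w) module, 'w) concrete_functor \<Rightarrow> ('o \<Rightarrow> 'v \<Rightarrow> 'w) \<Rightarrow> bool"
  where "natural_transformation k C F G \<eta> \<longleftrightarrow>
    (\<forall>x\<in>Ob C. \<eta> x \<in> mod_hom k (on_ob F x) (on_ob G x)) \<and>
    (\<forall>x\<in>Ob C. \<forall>y\<in>Ob C. \<forall>f\<in>Hom C x y. \<forall>u\<in>carrier (on_ob F x).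
      \<eta> y (on_arr F f u) = on_arr G f (\<eta> x u))"

definition isomorphic_functors ::
    "('k, 'r) ring_scheme \<Rightarrow> ('o, 'm, 'z) cat_scheme \<Rightarrow> ('o, 'm, ('k, 'v) module, 'v) concrete_functor
      \<Rightarrow> ('o, 'm, ('k, 'w) module, 'w) concrete_functor \<Rightarrow> bool"
  where "isomorphic_functors k C F G \<longleftrightarrow>
    module_functor k C F \<and> module_functor k C G \<and>
    (\<exists>\<eta> \<theta>. natural_transformation k C F G \<eta> \<and> natural_transformation k C G F \<theta> \<and>
      (\<forall>x\<in>Ob C. (\<forall>u\<in>carrier (on_ob F x). \<theta> x (\<eta> x u) = u) \<and>
                 (\<forall>w\<in>carrier (on_ob G x). \<eta> x (\<theta> x w) = w)))"


section \<open>Tensor products of abelian groups and \<open>k\<close>-trivial functors\<close>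

definition tensor_relations ::
    "('a, 'p) monoid_scheme \<Rightarrow> ('b, 'q) monoid_scheme \<Rightarrow> ('a \<times> 'b \<Rightarrow>\<^sub>0 int) set"
  where "tensor_relations G H =
    {frag_of (a \<otimes>\<^bsub>G\<^esub> a', b) - frag_of (a, b) - frag_of (a', b) | a a' b.
      a \<in> carrier G \<and> a' \<in> carrier G \<and> b \<in> carrier H} \<union>
    {frag_of (a, b \<otimes>\<^bsub>H\<^esub> b') - frag_of (a, b) - frag_of (a, b') | a b b'.
      a \<in> carrier G \<and> b \<in> carrier H \<and> b' \<in> carrier H}"

text \<open>The tensor product over the integers of two abelian groups.\<close>

definition tensor ::
    "('a, 'p) monoid_scheme \<Rightarrow> ('b, 'q) monoid_scheme \<Rightarrow> ('a \<times> 'b \<Rightarrow>\<^sub>0 int) set monoid"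
  where "tensor G H = (let F = free_Abelian_group (carrier G \<times> carrier H)
    in F Mod generate F (tensor_relations G H))"

text \<open>
  A functor to modules is zero iff its values are, and a module is zero iff its underlying
  abelian group is.
\<close>

definition k_trivial ::
    "('k, 'r) ring_scheme \<Rightarrow> ('o, 'm, 'z) cat_scheme \<Rightarrow> ('o, 'm, 'a monoid, 'a) concrete_functor \<Rightarrow> bool"
  where "k_trivial k C A \<longleftrightarrow>
    (\<forall>x\<in>Ob C. finite (carrier (on_ob A x)) \<and> trivial_group (tensor (add_monoid k) (on_ob A x)))"


section \<open>The dual of a finite abelian group\<close>

definition rat_group :: "rat monoid"
  where "rat_group = \<lparr>carrier = UNIV, monoid.mult = (+), one = 0\<rparr>"

definition rat_mod_int :: "rat set monoid"
  where "rat_mod_int = rat_group Mod \<int>"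

text \<open>Homomorphisms are made extensional so that equal maps are equal as elements.\<close>

definition dual_group :: "('a, 'p) monoid_scheme \<Rightarrow> ('a \<Rightarrow> rat set) monoid"
  where "dual_group V =
    \<lparr>carrier = hom V rat_mod_int \<inter> extensional (carrier V),
     monoid.mult = (\<lambda>\<phi> \<psi>. \<lambda>v\<in>carrier V. \<phi> v \<otimes>\<^bsub>rat_mod_int\<^esub> \<psi> v),
     one = (\<lambda>v\<in>carrier V. \<one>\<^bsub>rat_mod_int\<^esub>)\<rparr>"

text \<open>
  \<open>A^#\<close> is contravariant: an arrow \<open>f\<close> from \<open>x\<close> to \<open>y\<close> acts from the dual of \<open>A y\<close> to the dual
  of \<open>A x\<close>.
\<close>

definition dual_functor ::
    "('o, 'm, 'z) cat_scheme \<Rightarrow> ('o, 'm, 'a monoid, 'a) concrete_functor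
      \<Rightarrow> ('o, 'm, ('a \<Rightarrow> rat set) monoid, 'a \<Rightarrow> rat set) concrete_functor"
  where "dual_functor C A =
    \<lparr>on_ob = (\<lambda>x. dual_group (on_ob A x)),
     on_arr = (\<lambda>f \<phi>. \<lambda>v\<in>carrier (on_ob A (Dom C f)). \<phi> (on_arr A f v))\<rparr>"


section \<open>The functors \<open>k[A]\<close> and \<open>k^B\<close>\<close>

text \<open>
  The ring operations \<open>mult\<close> and \<open>one\<close> that the record type of modules inherits play no role
  for modules.  The module \<open>k^E\<close> consists of the functions on \<open>E\<close> (extended by
  \<open>undefined\<close>), and \<open>k[E]\<close> of those with finite support, the basis element of \<open>e\<close> being the
  indicator function of \<open>e\<close>.
\<close>

definition fun_module :: "('k, 'r) ring_scheme \<Rightarrow> 'e set \<Rightarrow> ('k, 'e \<Rightarrow> 'k) module"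
  where "fun_module k E =
    \<lparr>carrier = E \<rightarrow>\<^sub>E carrier k,
     monoid.mult = undefined, one = undefined,
     ring.zero = (\<lambda>e\<in>E. \<zero>\<^bsub>k\<^esub>),
     ring.add = (\<lambda>u v. \<lambda>e\<in>E. u e \<oplus>\<^bsub>k\<^esub> v e),
     smult = (\<lambda>c u. \<lambda>e\<in>E. c \<otimes>\<^bsub>k\<^esub> u e)\<rparr>"

definition free_module :: "('k, 'r) ring_scheme \<Rightarrow> 'e set \<Rightarrow> ('k, 'e \<Rightarrow> 'k) module"
  where "free_module k E =
    (fun_module k E) \<lparr>carrier := {u \<in> E \<rightarrow>\<^sub>E carrier k. finite {e \<in> E. u e \<noteq> \<zero>\<^bsub>k\<^esub>}}\<rparr>"

text \<open>The \<open>k\<close>-linear extension of a map \<open>s\<close> from \<open>E\<close> to \<open>E'\<close>.\<close>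

definition free_map ::
    "('k, 'r) ring_scheme \<Rightarrow> 'e set \<Rightarrow> 'd set \<Rightarrow> ('e \<Rightarrow> 'd) \<Rightarrow> ('e \<Rightarrow> 'k) \<Rightarrow> ('d \<Rightarrow> 'k)"
  where "free_map k E E' s u = (\<lambda>d\<in>E'. \<Oplus>\<^bsub>k\<^esub>e\<in>{e \<in> E. s e = d \<and> u e \<noteq> \<zero>\<^bsub>k\<^esub>}. u e)"

definition free_functor ::
    "('k, 'r) ring_scheme \<Rightarrow> ('o, 'm, 'z) cat_scheme \<Rightarrow> ('o, 'm, 'a monoid, 'a) concrete_functor
      \<Rightarrow> ('o, 'm, ('k, 'a \<Rightarrow> 'k) module, 'a \<Rightarrow> 'k) concrete_functor"
  where "free_functor k C A =
    \<lparr>on_ob = (\<lambda>x. free_module k (carrier (on_ob A x))),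
     on_arr = (\<lambda>f. free_map k (carrier (on_ob A (Dom C f))) (carrier (on_ob A (Cod C f)))
       (on_arr A f))\<rparr>"

text \<open>For contravariant \<open>B\<close>, the covariant functor \<open>k^B\<close>, acting by precomposition.\<close>

definition fun_functor ::
    "('k, 'r) ring_scheme \<Rightarrow> ('o, 'm, 'z) cat_scheme \<Rightarrow> ('o, 'm, 'b monoid, 'b) concrete_functor
      \<Rightarrow> ('o, 'm, ('k, 'b \<Rightarrow> 'k) module, 'b \<Rightarrow> 'k) concrete_functor"
  where "fun_functor k C B =
    \<lparr>on_ob = (\<lambda>x. fun_module k (carrier (on_ob B x))),
     on_arr = (\<lambda>f w. \<lambda>b\<in>carrier (on_ob B (Cod C f)). w (on_arr B f b))\<rparr>"

end

theory Submission
  imports Defs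
begin

text \<open>
  Over a ring with enough roots of unity the isomorphism would be a Fourier transform.  In
  general one looks for a function \<open>g\<close> on \<open>\<rat>/\<int>\<close> such that \<open>[v] \<mapsto> (\<phi> \<mapsto> g(\<phi>(v)))\<close>, which is
  always natural, is bijective whenever the order \<open>n\<close> of \<open>V\<close> is invertible in \<open>k\<close> (this is what
  \<open>k \<otimes> V = 0\<close> means).  An integer-valued one works: \<open>g(q)\<close> is 2 to the number of primes \<open>p\<close> for
  which the \<open>p\<close>-primary component of \<open>q\<close> is \<open>1/p^i\<close> with \<open>i > 0\<close>.

  For cyclic groups, the dilates \<open>b \<mapsto> g(a b / n)\<close> span all functions on \<open>\<int>/n\<close> once \<open>n\<close> is
  invertible.  Hence the matrix rows \<open>\<phi> \<mapsto> g(\<phi>(v))\<close> span every function \<open>\<phi> \<mapsto> F(\<phi>(v))\<close>.  Let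
  \<open>F\<close> be the convolution product of \<open>\<delta>_0 - \<delta>_(1/p)\<close> over the primes \<open>p\<close> dividing \<open>n\<close>: its sum over
  every nontrivial subgroup of \<open>\<int>/n\<close> vanishes and \<open>F(0) = 1\<close>, so the sum over \<open>v\<close> of
  \<open>F(\<phi>(v) - \<theta>(v))\<close> is \<open>n\<close> if \<open>\<phi> = \<theta>\<close> and 0 otherwise.  This exhibits all \<open>\<delta>_\<theta>\<close> in the span of the
  rows; exchanging \<open>V\<close> and its dual gives the columns.
\<close>

text \<open>Naturality compares groups of different orders, so the kernel may depend only on the
  value \<phi>(v) in \<rat>/\<int>, never on the order of the group. This is why
  \<open>std_part\<close> accepts 1/p^i for every i \<ge> 1: among the fractions b/p^e it marks the
  classes b = p^j with j < e, exactly one in each nonzero orbit of the units modulo p^e, at all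
  levels e simultaneously. The compatibility between levels is what an induction on e can exploit.
  Unmarked classes get the value 1, so primes not dividing the order contribute nothing and the
  group of order 1 gives a nonzero constant; marked classes get 2, so that subtracting the constant
  1 leaves exactly the indicator of the marked classes. The ring k may have zero divisors and few
  roots of unity, so the inversion of the matrix is prepared over the integers: every spanning
  statement ends as an identity n^r \<delta> = \<Sum> a K with integers a. Such an identity can be
  mapped to k, where n becomes a unit. One for each row and each column yields surjectivity and
  injectivity directly, without determinants.\<close>

hide_const (open) Divisibility.prime

section \<open>Functions on the integers up to denominators\<close>

text \<open>
  The integer-valued functions in the \<open>\<int>[1/N]\<close>-linear span of \<open>B\<close>.
\<close>

inductive_set zspan :: "int \<Rightarrow> ('x \<Rightarrow> int) set \<Rightarrow> ('x \<Rightarrow> int) set" for N B where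
  gen: "f \<in> B \<Longrightarrow> f \<in> zspan N B"
| zero: "(\<lambda>_. 0) \<in> zspan N B"
| add: "\<lbrakk>f \<in> zspan N B; h \<in> zspan N B\<rbrakk> \<Longrightarrow> (\<lambda>x. f x + h x) \<in> zspan N B"
| scale: "f \<in> zspan N B \<Longrightarrow> (\<lambda>x. c * f x) \<in> zspan N B"
| divide: "(\<lambda>x. N * f x) \<in> zspan N B \<Longrightarrow> f \<in> zspan N B"

lemma zspan_diff:
  assumes "f \<in> zspan N B" "h \<in> zspan N B"
  shows "(\<lambda>x. f x - h x) \<in> zspan N B"
  using zspan.add[OF assms(1) zspan.scale[OF assms(2), of "-1"]] by simp

lemma zspan_sum:
  "(\<And>i. i \<in> I \<Longrightarrow> f i \<in> zspan N B) \<Longrightarrow> (\<lambda>x. \<Sum>i\<in>I. f i x) \<in> zspan N B"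
  by (induction I rule: infinite_finite_induct) (auto intro: zspan.zero zspan.add)

lemma zspan_divide_dvd:
  assumes "(\<lambda>x. M * f x) \<in> zspan N B" "M dvd N"
  shows "f \<in> zspan N B"
proof -
  obtain c where "N = M * c" using assms(2) by auto
  then have "(\<lambda>x. N * f x) \<in> zspan N B"
    using zspan.scale[OF assms(1), of c] by (simp add: mult_ac)
  then show ?thesis by (rule zspan.divide)
qed

text \<open>Multiplication by \<open>h\<close> is linear, so only generators matter;
  \<open>N dvd N'\<close> keeps the divisions performed in the source legitimate in the target.
  \<open>zspan_trans\<close> is the case of the constant 1, and \<open>zspan_mult\<close> uses the
  lemma once in each factor.\<close>

lemma zspan_mult_right:
  assumes "f \<in> zspan N B" "N dvd N'"
    and "\<And>b. b \<in> B \<Longrightarrow> (\<lambda>x. b x * h x) \<in> zspan N' B'"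
  shows "(\<lambda>x. f x * h x) \<in> zspan N' B'"
  using assms(1)
proof induction
  case (scale f c)
  then show ?case using zspan.scale[of _ N' B' c] by (simp add: mult.assoc)
next
  case (divide f)
  then have "(\<lambda>x. N * (f x * h x)) \<in> zspan N' B'" by (simp add: mult.assoc)
  then show ?case by (rule zspan_divide_dvd) fact
qed (auto simp: distrib_right assms(3) intro: zspan.zero zspan.add)

lemma zspan_trans:
  assumes "f \<in> zspan N B" "N dvd N'" "\<And>b. b \<in> B \<Longrightarrow> b \<in> zspan N' B'"
  shows "f \<in> zspan N' B'"
  using zspan_mult_right[OF assms(1,2), of "\<lambda>_. 1"] assms(3) by simp

lemma zspan_mult:
  assumes "f \<in> zspan M B" "h \<in> zspan N B'" "M dvd L" "N dvd L"
    and "\<And>b b'. \<lbrakk>b \<in> B; b' \<in> B'\<rbrakk> \<Longrightarrow> (\<lambda>x. b x * b' x) \<in> zspan L D"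
  shows "(\<lambda>x. f x * h x) \<in> zspan L D"
proof (rule zspan_mult_right[OF assms(1,3)])
  fix b assume "b \<in> B"
  then have "(\<lambda>x. b' x * b x) \<in> zspan L D" if "b' \<in> B'" for b'
    using assms(5)[of b b'] that by (simp add: mult.commute)
  then have "(\<lambda>x. h x * b x) \<in> zspan L D"
    by (rule zspan_mult_right[OF assms(2,4)])
  then show "(\<lambda>x. b x * h x) \<in> zspan L D" by (simp add: mult.commute)
qed

lemma zspan_comp:
  assumes "f \<in> zspan N B" "\<And>b. b \<in> B \<Longrightarrow> (\<lambda>x. b (h x)) \<in> zspan N B'"
  shows "(\<lambda>x. f (h x)) \<in> zspan N B'"
  using assms(1)
  by induction (auto intro: assms(2) zspan.zero zspan.add zspan.scale zspan.divide)

text \<open>This is the exit from the span: all divisions are collected into one power of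
  \<open>N\<close>, which leaves an identity between integers that makes sense in every
  ring.\<close>

lemma zspan_linear_combination:
  assumes "f \<in> zspan N (K ` V)" "finite V"
  shows "\<exists>r a. \<forall>x. N ^ r * f x = (\<Sum>v\<in>V. a v * K v x)"
  using assms(1)
proof induction
  case (gen f)
  then obtain v where "v \<in> V" "f = K v" by auto
  then have "\<forall>x. N ^ 0 * f x = (\<Sum>w\<in>V. of_bool (w = v) * K w x)"
    using assms(2) by (simp add: sum.remove)
  then show ?case by (intro exI)
next
  case zero
  have "\<forall>x. N ^ 0 * 0 = (\<Sum>v\<in>V. 0 * K v x)" by simp
  then show ?case by (intro exI)
next
  case (add f h)
  then obtain r s a b where
    f: "\<And>x. N ^ r * f x = (\<Sum>v\<in>V. a v * K v x)" and
    h: "\<And>x. N ^ s * h x = (\<Sum>v\<in>V. b v * K v x)"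
    by blast
  have "N ^ (r + s) * (f x + h x) = (\<Sum>v\<in>V. (N ^ s * a v + N ^ r * b v) * K v x)" for x
  proof -
    have "N ^ (r + s) * (f x + h x) = N ^ s * (N ^ r * f x) + N ^ r * (N ^ s * h x)"
      by (simp add: power_add algebra_simps)
    also have "\<dots> = (\<Sum>v\<in>V. (N ^ s * a v + N ^ r * b v) * K v x)"
      by (simp add: f h sum_distrib_left distrib_right sum.distrib mult.assoc)
    finally show ?thesis .
  qed
  then show ?case by (intro exI allI)
next
  case (scale f c)
  then obtain r a where f: "\<And>x. N ^ r * f x = (\<Sum>v\<in>V. a v * K v x)"
    by blast
  have "N ^ r * (c * f x) = (\<Sum>v\<in>V. (c * a v) * K v x)" for x
  proof -
    have "N ^ r * (c * f x) = c * (N ^ r * f x)" by simp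
    then show ?thesis by (simp add: f sum_distrib_left mult.assoc)
  qed
  then show ?case by (intro exI allI)
next
  case (divide f)
  then obtain r a where f: "\<And>x. N ^ r * (N * f x) = (\<Sum>v\<in>V. a v * K v x)"
    by blast
  have "N ^ Suc r * f x = (\<Sum>v\<in>V. a v * K v x)" for x
    using f[of x] by (simp add: mult.assoc mult.left_commute)
  then show ?case by (intro exI allI)
qed

text \<open>The indicator of the class of \<open>t\<close> modulo \<open>n\<close>, kept as a
  function on all integers so that different moduli can be compared.\<close>

definition residue_delta :: "int \<Rightarrow> int \<Rightarrow> int \<Rightarrow> int"
  where "residue_delta n t b = of_bool (n dvd b - t)"

text \<open>A class modulo \<open>M\<close> is the disjoint union of \<open>c\<close> classes modulo
  \<open>M * c\<close>.\<close>

lemma residue_delta_coarsen: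
  assumes "c > 0" "M \<noteq> 0"
  shows "(\<Sum>i<c. residue_delta (M * int c) (t + int i * M) b) = residue_delta M t b"
proof (cases "M dvd b - t")
  case True
  then obtain s where s: "b - t = M * s" by auto
  \<comment> \<open>With b = t + M s, the finer class that contains b is the one whose index is the
    residue of s modulo c.\<close>
  have "residue_delta (M * int c) (t + int i * M) b = of_bool (i = nat (s mod int c))"
    if "i < c" for i
  proof -
    have "b - (t + int i * M) = M * (s - int i)" using s by (simp add: algebra_simps)
    then have "M * int c dvd b - (t + int i * M) \<longleftrightarrow> int c dvd s - int i"
      using assms(2) by simp
    also have "\<dots> \<longleftrightarrow> s mod int c = int i mod int c" by (simp add: mod_eq_dvd_iff)
    also have "\<dots> \<longleftrightarrow> i = nat (s mod int c)" using that by auto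
    finally show ?thesis by (simp add: residue_delta_def)
  qed
  moreover have "nat (s mod int c) < c" using assms(1) by (simp add: nat_less_iff)
  ultimately show ?thesis using True by (simp add: residue_delta_def of_bool_def)
next
  case False
  have "residue_delta (M * int c) (t + int i * M) b = 0" for i
  proof -
    have "\<not> M dvd b - t - int i * M"
      using False by (simp add: dvd_diff_left_iff)
    then show ?thesis
      by (auto simp: residue_delta_def diff_diff_eq dest: dvd_mult_left)
  qed
  then show ?thesis using False by (simp add: residue_delta_def)
qed

section \<open>A function on the rationals modulo 1\<close>

text \<open>The \<open>p\<close>-primary component of \<open>q\<close> in \<open>\<rat>/\<int>\<close> is \<open>1/p^i\<close> for some positive \<open>i\<close>.\<close>

definition std_part :: "nat \<Rightarrow> rat \<Rightarrow> bool"
  where "std_part p q \<longleftrightarrow>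
    (\<exists>i\<ge>1. \<exists>m::int. coprime m (int p) \<and> of_int m * (q - 1 / of_nat p ^ i) \<in> \<int>)"

definition local_factor :: "nat \<Rightarrow> rat \<Rightarrow> int"
  where "local_factor p q = (if std_part p q then 2 else 1)"

text \<open>A difference killed by some \<open>m\<close> prime to \<open>p\<close> has trivial
  \<open>p\<close>-component. The multiplier witnessing the claim for \<open>q'\<close> is the
  product of \<open>m\<close> with the one for \<open>q\<close>.\<close>

lemma std_part_mono:
  assumes "coprime m (int p)" "of_int m * (q - q') \<in> \<int>" "std_part p q"
  shows "std_part p q'"
proof -
  obtain i m' where i: "i \<ge> 1" "coprime m' (int p)" "of_int m' * (q - 1 / of_nat p ^ i) \<in> \<int>"
    using assms(3) by (auto simp: std_part_def)
  have "of_int (m * m') * (q' - 1 / of_nat p ^ i) =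
      of_int m * (of_int m' * (q - 1 / of_nat p ^ i)) - of_int m' * (of_int m * (q - q'))"
    by (simp add: algebra_simps)
  also have "\<dots> \<in> \<int>" using i(3) assms(2)
    by (intro Ints_diff[OF Ints_mult[OF Ints_of_int] Ints_mult[OF Ints_of_int]])
  finally show ?thesis
    using i assms(1) unfolding std_part_def by (intro exI[of _ i] conjI exI[of _ "m * m'"]) auto
qed

lemma local_factor_cong:
  assumes "coprime m (int p)" "of_int m * (q - q') \<in> \<int>"
  shows "local_factor p q = local_factor p q'"
proof -
  have "of_int m * (q' - q) \<in> \<int>"
    using Ints_minus[OF assms(2)] by (simp add: algebra_simps)
  then show ?thesis
    using std_part_mono[OF assms(1)] assms(2) by (auto simp: local_factor_def)
qed

text \<open>Since 1/p^i = p^(e-i)/p^e, the exponents correspond by j = e - i. An exponent i > e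
  cannot occur: p^e kills b/p^e but not the class of 1/p^i; in the proof p would divide both b
  p^(i-e) and b p^(i-e) - 1.\<close>

lemma std_part_prime_power:
  assumes "prime p"
  shows "std_part p (of_int b / of_nat p ^ e) \<longleftrightarrow> (\<exists>j<e. int p ^ e dvd b - int p ^ j)"
proof
  assume "std_part p (of_int b / of_nat p ^ e)"
  then obtain i m z where i: "i \<ge> 1" and m: "coprime m (int p)"
    and z: "of_int m * (of_int b / of_nat p ^ e - 1 / of_nat p ^ i) = (of_int z :: rat)"
    by (auto simp: std_part_def Ints_def)
  have p: "p > 1" using assms by (rule prime_gt_1_nat)
  show "\<exists>j<e. int p ^ e dvd b - int p ^ j"
  proof (cases "i \<le> e")
    case True
    then have "(of_nat p :: rat) ^ e = of_nat p ^ (e - i) * of_nat p ^ i"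
      by (simp flip: power_add)
    then have "(of_int (m * (b - int p ^ (e - i))) :: rat) = of_int (z * int p ^ e)"
      using p z by (simp add: field_simps)
    then have "m * (b - int p ^ (e - i)) = z * int p ^ e"
      unfolding of_int_eq_iff .
    then have "int p ^ e dvd m * (b - int p ^ (e - i))" by simp
    then have "int p ^ e dvd b - int p ^ (e - i)"
      using m by (subst (asm) coprime_dvd_mult_right_iff) (auto simp: coprime_commute)
    then show ?thesis using i True by (intro exI[of _ "e - i"]) auto
  next
    case False
    then have "(of_nat p :: rat) ^ i = of_nat p ^ (i - e) * of_nat p ^ e"
      by (simp flip: power_add)
    then have "(of_int (m * (b * int p ^ (i - e) - 1)) :: rat) = of_int (z * int p ^ i)"
      using p z by (simp add: field_simps)
    then have "m * (b * int p ^ (i - e) - 1) = z * int p ^ i"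
      unfolding of_int_eq_iff .
    then have "int p dvd m * (b * int p ^ (i - e) - 1)"
      using i by (simp add: dvd_power)
    then have "int p dvd b * int p ^ (i - e) - 1"
      using m by (subst (asm) coprime_dvd_mult_right_iff) (auto simp: coprime_commute)
    moreover have "int p dvd b * int p ^ (i - e)"
      using False by (simp add: dvd_power)
    ultimately have "int p dvd b * int p ^ (i - e) - (b * int p ^ (i - e) - 1)"
      by (rule dvd_diff[rotated])
    then show ?thesis using p by simp
  qed
next
  assume "\<exists>j<e. int p ^ e dvd b - int p ^ j"
  then obtain j s where j: "j < e" and "b - int p ^ j = int p ^ e * s"
    by (auto simp: dvd_def)
  then have "(of_int b :: rat) = of_nat p ^ j + of_nat p ^ e * of_int s"
    by (metis add.commute diff_add_cancel of_int_add of_int_mult of_int_of_nat_eq of_int_power)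
  moreover have "(of_nat p :: rat) ^ e = of_nat p ^ (e - j) * of_nat p ^ j"
    using j by (simp flip: power_add)
  ultimately have "of_int 1 * ((of_int b :: rat) / of_nat p ^ e - 1 / of_nat p ^ (e - j)) = of_int s"
    using prime_gt_0_nat[OF assms] by (simp add: field_simps)
  then have "of_int 1 * ((of_int b :: rat) / of_nat p ^ e - 1 / of_nat p ^ (e - j)) \<in> \<int>"
    by (metis Ints_of_int)
  then show "std_part p (of_int b / of_nat p ^ e)"
    using j unfolding std_part_def by (intro exI[of _ "e - j"] conjI exI[of _ 1]) auto
qed

text \<open>The classes of p^j for j < e are pairwise distinct modulo p^e, so at most one of the
  deltas is nonzero at b.\<close>

lemma local_factor_prime_power:
  assumes "prime p"
  shows "local_factor p (of_int b / of_nat p ^ e) = 1 + (\<Sum>j<e. residue_delta (int p ^ e) (int p ^ j) b)"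
proof (cases "\<exists>j<e. int p ^ e dvd b - int p ^ j")
  case True
  then obtain j where j: "j < e" "int p ^ e dvd b - int p ^ j" by blast
  have p: "p > 1" using assms by (rule prime_gt_1_nat)
  \<comment> \<open>For k < l the difference p^l - p^k has p-adic valuation exactly k, which is less
    than e.\<close>
  have not_dvd: "\<not> int p ^ e dvd int p ^ l - int p ^ k" if "k < l" "l < e" for k l
  proof
    assume "int p ^ e dvd int p ^ l - int p ^ k"
    moreover have "int p ^ Suc k dvd int p ^ e" "int p ^ Suc k dvd int p ^ l"
      using that le_imp_power_dvd[of "Suc k" e "int p"] le_imp_power_dvd[of "Suc k" l "int p"]
      by auto
    ultimately have "int p ^ Suc k dvd int p ^ k"
      by (meson dvd_diff_right_iff dvd_trans)
    then have "int p ^ Suc k \<le> int p ^ k" using p by (intro zdvd_imp_le) auto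
    then show False using p power_strict_increasing[of k "Suc k" "int p"] by simp
  qed
  have "residue_delta (int p ^ e) (int p ^ i) b = of_bool (i = j)" if "i < e" for i
  proof -
    have "i = j" if "int p ^ e dvd b - int p ^ i"
    proof -
      have "int p ^ e dvd int p ^ i - int p ^ j" "int p ^ e dvd int p ^ j - int p ^ i"
        using dvd_diff[OF j(2) that] dvd_diff[OF that j(2)] by simp_all
      then show ?thesis using not_dvd[of i j] not_dvd[of j i] \<open>i < e\<close> j(1)
        by (cases i j rule: linorder_cases) auto
    qed
    then have "int p ^ e dvd b - int p ^ i \<longleftrightarrow> i = j" using j(2) by blast
    then show ?thesis unfolding residue_delta_def by (rule arg_cong)
  qed
  then have "(\<Sum>i<e. residue_delta (int p ^ e) (int p ^ i) b) = (\<Sum>i<e. of_bool (i = j))"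
    by (intro sum.cong) simp_all
  also have "\<dots> = (1::int)"
    unfolding of_bool_def using j(1) by (subst sum.delta) simp_all
  finally show ?thesis
    using True unfolding local_factor_def std_part_prime_power[OF assms] by simp
next
  case False
  then have "(\<Sum>i<e. residue_delta (int p ^ e) (int p ^ i) b) = 0"
    unfolding residue_delta_def by (intro sum.neutral) simp_all
  then show ?thesis
    using False unfolding local_factor_def std_part_prime_power[OF assms] by simp
qed

text \<open>Dilates are the operations available for free: replacing \<phi>(v) by a \<phi>(v)
  amounts to replacing v by a power of v, hence one row of the matrix by another. Translates have no
  such interpretation and must be obtained as combinations of dilates.\<close>

definition dilates :: "(rat \<Rightarrow> int) \<Rightarrow> nat \<Rightarrow> (int \<Rightarrow> int) set"
  where "dilates g n = range (\<lambda>a b. g (of_int (a * b) / of_nat n))"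

lemma dilate_mem: "(\<lambda>b. g (of_int (a * b) / of_nat n)) \<in> dilates g n"
  unfolding dilates_def by blast

lemma dilates_dvd:
  assumes "n dvd n'" "n' > 0"
  shows "dilates g n \<subseteq> dilates g n'"
proof
  fix f assume "f \<in> dilates g n"
  then obtain a where f: "f = (\<lambda>b. g (of_int (a * b) / of_nat n))"
    by (auto simp: dilates_def)
  obtain c where c: "n' = n * c" using assms(1) by auto
  have "f = (\<lambda>b. g (of_int ((int c * a) * b) / of_nat n'))"
    using assms(2) c unfolding f by (simp add: mult.assoc)
  then show "f \<in> dilates g n'" by (simp only: dilate_mem)
qed

lemma residue_delta_unit_dilate:
  assumes "n dvd u * w - 1"
  shows "residue_delta n t (w * b) = residue_delta n (u * t) b"
proof -
  have n: "coprime n w"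
  proof (rule coprimeI)
    fix c assume "c dvd n" "c dvd w"
    then have "c dvd u * w" "c dvd u * w - 1" using assms by (auto intro: dvd_trans)
    then have "c dvd u * w - (u * w - 1)" by (rule dvd_diff)
    then show "is_unit c" by simp
  qed
  \<comment> \<open>The integers w b - t and w (b - u t) differ by the multiple (u w - 1) t of
    n.\<close>
  have "n dvd w * b - t \<longleftrightarrow> n dvd w * b - t + (u * w - 1) * t"
    using assms by (simp add: dvd_add_left_iff)
  also have "w * b - t + (u * w - 1) * t = w * (b - u * t) + 2 * ((u * w - 1) * t)"
    by (simp add: algebra_simps)
  also have "n dvd \<dots> \<longleftrightarrow> n dvd w * (b - u * t)"
    using assms by (simp add: dvd_add_left_iff)
  also have "\<dots> \<longleftrightarrow> n dvd b - u * t"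
    using n by (simp add: coprime_dvd_mult_right_iff)
  finally show ?thesis by (simp add: residue_delta_def)
qed

text \<open>
  Functions of period \<open>p^e\<close> are available by induction.  Modulo these, for a unit \<open>u\<close> one has
  the sum of the deltas at \<open>u p^j\<close> over \<open>s \<le> j \<le> e\<close>, at first with \<open>s = 0\<close>.  Averaging it over the
  \<open>p\<close> units \<open>u + i p^(e-s)\<close> turns the term \<open>j = s\<close> into a function of period \<open>p^e\<close> and fixes
  the others, so \<open>s\<close> can be increased and each single delta is a difference of two tails.
\<close>

lemma prime_power_residue_delta:
  assumes p: "prime p"
  shows "residue_delta (int p ^ e) t \<in> zspan (int p) (dilates (local_factor p) (p ^ e))"
proof (induction e arbitrary: t)
  case 0
  have eq: "residue_delta (int p ^ 0) t =
      (\<lambda>b. local_factor p (of_int (0 * b) / of_nat (p ^ 0)))"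
    using local_factor_prime_power[OF p, of 0 0] by (simp add: residue_delta_def fun_eq_iff)
  show ?case unfolding eq by (rule zspan.gen[OF dilate_mem])
next
  case (Suc e)
  let ?E = "Suc e"
  let ?S = "zspan (int p) (dilates (local_factor p) (p ^ ?E))"
  let ?V = "\<lambda>s u b. \<Sum>j=s..e. residue_delta (int p ^ ?E) (u * int p ^ j) b"
  have p1: "p > 1" using p by (rule prime_gt_1_nat)
  have periodic: "residue_delta (int p ^ e) t \<in> ?S" for t
    by (rule zspan_trans[OF Suc.IH dvd_refl zspan.gen])
       (use dilates_dvd[of "p ^ e" "p ^ ?E"] p1 in auto)
  \<comment> \<open>The constant 1 is the sum of all deltas modulo p^e; it is needed to remove the 1
    from the local factor.\<close>
  have const: "(\<lambda>_. 1) \<in> ?S"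
  proof -
    have "(\<lambda>b. \<Sum>i<p ^ e. residue_delta (int p ^ e) (int i) b) \<in> ?S"
      by (rule zspan_sum) (rule periodic)
    moreover have "(\<Sum>i<p ^ e. residue_delta (int p ^ e) (int i) b) = 1" for b
      using residue_delta_coarsen[of "p ^ e" 1 0 b] p1 by (simp add: residue_delta_def)
    ultimately show ?thesis by simp
  qed
  have base: "?V 0 u \<in> ?S" if u: "coprime u (int p)" for u
  proof -
    have "coprime u (int p ^ ?E)" using u by simp
    \<comment> \<open>Here w inverts u modulo p^(e+1), so dilating by w carries the marked classes
      p^j to u p^j.\<close>
    then obtain w y where "w * u + y * int p ^ ?E = 1"
      using bezout_int[of u "int p ^ ?E"] by (auto simp: coprime_iff_gcd_eq_1)
    then have "u * w - 1 = int p ^ ?E * (- y)" by (simp add: algebra_simps)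
    then have w': "int p ^ ?E dvd u * w - 1" by (rule dvdI)
    have eq: "local_factor p (of_int (w * b) / of_nat (p ^ ?E)) - 1 = ?V 0 u b" for b
    proof -
      have "local_factor p (of_int (w * b) / of_nat (p ^ ?E)) - 1 =
          (\<Sum>j<?E. residue_delta (int p ^ ?E) (int p ^ j) (w * b))"
        using local_factor_prime_power[OF p, of "w * b" ?E] by simp
      also have "\<dots> = (\<Sum>j<?E. residue_delta (int p ^ ?E) (u * int p ^ j) b)"
        by (intro sum.cong refl residue_delta_unit_dilate w')
      also have "{..<?E} = {0..e}" by auto
      finally show ?thesis .
    qed
    have "(\<lambda>b. local_factor p (of_int (w * b) / of_nat (p ^ ?E)) - 1) \<in> ?S"
      by (rule zspan_diff[OF zspan.gen[OF dilate_mem] const])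
    then show ?thesis by (simp only: eq)
  qed
  have tail: "?V s u \<in> ?S" if u: "coprime u (int p)" and "s \<le> ?E" for s u
    using that(2) u
  proof (induction s arbitrary: u)
    case 0
    then show ?case using base by simp
  next
    case (Suc s)
    show ?case
    proof (cases "s = e")
      \<comment> \<open>The sum over \<open>{Suc e..e}\<close> is empty. Including this tail makes
        the delta at j = e a difference of two tails as well.\<close>
      case True
      then show ?thesis using zspan.zero by simp
    next
      case False
      \<comment> \<open>The strict inequality makes p divide p^(e-s), so that every u + i p^(e-s) is
        still prime to p.\<close>
      then have s: "s < e" using Suc.prems by simp
      define u' where "u' = (\<lambda>i::nat. u + int i * int p ^ (e - s))"
      have "coprime (u' i) (int p)" for i
      proof -
        have "int p dvd int i * int p ^ (e - s)" using s by (simp add: dvd_power)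
        then obtain c where "int i * int p ^ (e - s) = int p * c" by auto
        then have "gcd (u' i) (int p) = gcd u (int p)" 
          unfolding u'_def using gcd_add_mult[of "int p" c u] by (simp add: gcd.commute algebra_simps)
        then show ?thesis using Suc.prems(2) by (simp add: coprime_iff_gcd_eq_1)
      qed
      then have "(\<lambda>b. \<Sum>i<p. ?V s (u' i) b) \<in> ?S"
        using s by (intro zspan_sum[where f = "\<lambda>i. ?V s (u' i)"] Suc.IH) auto
      moreover have "(\<Sum>i<p. ?V s (u' i) b) =
          residue_delta (int p ^ e) (u * int p ^ s) b + int p * ?V (Suc s) u b" for b
      proof -
        have "(\<Sum>i<p. ?V s (u' i) b) =
            (\<Sum>j=s..e. \<Sum>i<p. residue_delta (int p ^ ?E) (u' i * int p ^ j) b)"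
          by (rule sum.swap)
        also have "\<dots> = (\<Sum>i<p. residue_delta (int p ^ ?E) (u' i * int p ^ s) b) +
            (\<Sum>j=Suc s..e. \<Sum>i<p. residue_delta (int p ^ ?E) (u' i * int p ^ j) b)"
          using s by (simp add: sum.atLeast_Suc_atMost)
        also have "(\<Sum>i<p. residue_delta (int p ^ ?E) (u' i * int p ^ s) b) =
            residue_delta (int p ^ e) (u * int p ^ s) b"
        proof -
          have "u' i * int p ^ s = u * int p ^ s + int i * int p ^ e" for i
            using s by (simp add: u'_def distrib_right mult.assoc flip: power_add)
          then show ?thesis
            using residue_delta_coarsen[of p "int p ^ e" "u * int p ^ s" b] p1
            by (simp add: mult.commute)
        qed
        also have "(\<Sum>j=Suc s..e. \<Sum>i<p. residue_delta (int p ^ ?E) (u' i * int p ^ j) b) =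
            (\<Sum>j=Suc s..e. int p * residue_delta (int p ^ ?E) (u * int p ^ j) b)"
        proof (rule sum.cong[OF refl])
          \<comment> \<open>For j > s the shift i p^(e-s) p^j is divisible by p^(e+1), so all p
            units give the same delta.\<close>
          fix j assume j: "j \<in> {Suc s..e}"
          have "residue_delta (int p ^ ?E) (u' i * int p ^ j) b =
              residue_delta (int p ^ ?E) (u * int p ^ j) b" for i
          proof -
            have "int p ^ ?E dvd int p ^ (e - s + j)"
              using j s by (intro le_imp_power_dvd) auto
            then have "int p ^ ?E dvd int i * int p ^ (e - s + j)" by (rule dvd_mult)
            moreover have "b - u' i * int p ^ j = (b - u * int p ^ j) - int i * int p ^ (e - s + j)"
              by (simp add: u'_def algebra_simps power_add)
            ultimately show ?thesis
              unfolding residue_delta_def by (simp only: dvd_diff_left_iff)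
          qed
          then show "(\<Sum>i<p. residue_delta (int p ^ ?E) (u' i * int p ^ j) b) =
              int p * residue_delta (int p ^ ?E) (u * int p ^ j) b" by simp
        qed
        finally show ?thesis by (simp add: sum_distrib_left)
      qed
      ultimately have "(\<lambda>b. residue_delta (int p ^ e) (u * int p ^ s) b + int p * ?V (Suc s) u b) \<in> ?S"
        by simp
      from zspan_diff[OF this periodic[of "u * int p ^ s"]]
      have "(\<lambda>b. int p * ?V (Suc s) u b) \<in> ?S" by simp
      then show ?thesis by (rule zspan.divide)
    qed
  qed
  have nonzero: "residue_delta (int p ^ ?E) (u * int p ^ s) \<in> ?S"
    if u: "coprime u (int p)" and s: "s \<le> e" for s u
  proof -
    have "?V s u b - ?V (Suc s) u b = residue_delta (int p ^ ?E) (u * int p ^ s) b" for b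
      using s by (simp add: sum.atLeast_Suc_atMost)
    then show ?thesis
      using zspan_diff[OF tail[OF u, of s] tail[OF u, of "Suc s"]] s by simp
  qed
  show ?case
  proof (cases "int p ^ ?E dvd t")
    \<comment> \<open>The class of 0 modulo p^e consists of the classes of i p^e modulo p^(e+1) for
      0 \<le> i < p. Those with i > 0 have a unit coefficient and are already available, so the
      class of 0 is what remains.\<close>
    case True
    have "(\<lambda>b. residue_delta (int p ^ e) 0 b -
        (\<Sum>i\<in>{1..<p}. residue_delta (int p ^ ?E) (int i * int p ^ e) b)) \<in> ?S"
    proof (intro zspan_diff periodic zspan_sum)
      fix i assume "i \<in> {1..<p}"
      then have "\<not> p dvd i" by (auto dest: nat_dvd_not_less)
      then have "coprime (int i) (int p)"
        using p by (metis coprime_commute coprime_int_iff prime_imp_coprime)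
      then show "residue_delta (int p ^ ?E) (int i * int p ^ e) \<in> ?S" by (rule nonzero) simp
    qed
    moreover have "residue_delta (int p ^ e) 0 b -
        (\<Sum>i\<in>{1..<p}. residue_delta (int p ^ ?E) (int i * int p ^ e) b) =
        residue_delta (int p ^ ?E) t b" for b
    proof -
      have "{..<p} = insert 0 {1..<p}" using p1 by auto
      then have "residue_delta (int p ^ e) 0 b = residue_delta (int p ^ ?E) 0 b +
          (\<Sum>i\<in>{1..<p}. residue_delta (int p ^ ?E) (int i * int p ^ e) b)"
        using residue_delta_coarsen[of p "int p ^ e" 0 b] p1 by (simp add: mult.commute)
      moreover have "residue_delta (int p ^ ?E) 0 b = residue_delta (int p ^ ?E) t b"
        using True unfolding residue_delta_def by (simp only: dvd_diff_left_iff diff_0_right)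
      ultimately show ?thesis by simp
    qed
    ultimately show ?thesis by simp
  next
    case False
    define s where "s = multiplicity (int p) t"
    have t: "t \<noteq> 0" using False by auto
    have prime_p: "prime (int p)" using p by simp
    obtain u where u: "t = int p ^ s * u" "\<not> int p dvd u"
      using multiplicity_decompose'[of t "int p"] t prime_p unfolding s_def
      by (metis not_prime_unit)
    have "s \<le> e"
    proof (rule ccontr)
      assume "\<not> s \<le> e"
      then have "int p ^ ?E dvd int p ^ s" by (intro le_imp_power_dvd) auto
      then show False using False u(1) by (simp add: dvd_mult2)
    qed
    moreover have "coprime u (int p)"
      using u(2) prime_p by (metis coprime_commute prime_imp_coprime)
    ultimately show ?thesis using nonzero[of u s] u(1) by (simp add: mult.commute)
  qed
qed

text \<open>The product of \<open>local_factor p q\<close> over all primes p, written as a power of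
  2 to avoid an infinite product; only primes dividing the denominator of \<open>q\<close> can
  contribute.\<close>

definition duality_kernel :: "rat \<Rightarrow> int"
  where "duality_kernel q = 2 ^ card {p. prime p \<and> std_part p q}"

lemma duality_kernel_cong:
  assumes "q - q' \<in> \<int>"
  shows "duality_kernel q = duality_kernel q'"
proof -
  have "q' - q \<in> \<int>" using Ints_minus[OF assms] by simp
  then have "std_part p q \<longleftrightarrow> std_part p q'" for p
    using assms std_part_mono[of 1 p q q'] std_part_mono[of 1 p q' q] by auto
  then show ?thesis by (simp add: duality_kernel_def)
qed

text \<open>A prime p at which q has a component 1/p^i with i \<ge> 1 divides every n that kills q:
  with m prime to p as in \<open>std_part\<close>, p divides m n.\<close>

lemma duality_kernel_eq_prod:
  assumes "n > 0" "of_nat n * q \<in> \<int>"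
  shows "duality_kernel q = (\<Prod>p\<in>prime_factors n. local_factor p q)"
proof -
  have dvd: "p dvd n" if p: "prime p" "std_part p q" for p
  proof -
    obtain i m z where i: "i \<ge> 1" "coprime m (int p)"
      and z: "of_int m * (q - 1 / of_nat p ^ i) = (of_int z :: rat)"
      using p(2) by (auto simp: std_part_def Ints_def)
    obtain y where y: "of_nat n * q = (of_int y :: rat)" using assms(2) by (auto simp: Ints_def)
    have "p > 0" using p(1) by (rule prime_gt_0_nat)
    then have "(of_int (m * int n) :: rat) = of_nat p ^ i * (of_int m * (of_nat n * q) -
        of_nat n * (of_int m * (q - 1 / of_nat p ^ i)))"
      by (simp add: field_simps)
    also have "\<dots> = of_int (int p ^ i * (m * y - int n * z))" by (simp add: y z)
    finally have "m * int n = int p ^ i * (m * y - int n * z)" unfolding of_int_eq_iff .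
    then have "int p dvd m * int n" using i(1) by (simp add: dvd_power)
    then have "int p dvd int n"
      using i(2) by (subst (asm) coprime_dvd_mult_right_iff) (auto simp: coprime_commute)
    then show ?thesis by simp
  qed
  have "(\<Prod>p\<in>prime_factors n. local_factor p q) = (\<Prod>p | p \<in> prime_factors n \<and> std_part p q. 2)"
    unfolding local_factor_def by (simp add: prod.If_cases Int_def)
  also have "{p. p \<in> prime_factors n \<and> std_part p q} = {p. prime p \<and> std_part p q}"
    using assms(1) dvd by (auto simp: in_prime_factors_iff)
  finally show ?thesis by (simp add: duality_kernel_def)
qed

section \<open>From prime powers to arbitrary moduli by Chinese remaindering\<close>

lemma residue_delta_mult:
  assumes "coprime m n"
  shows "residue_delta (m * n) t b = residue_delta m t b * residue_delta n t b"
proof -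
  have "m * n dvd b - t \<longleftrightarrow> m dvd b - t \<and> n dvd b - t"
    using assms by (auto intro: divides_mult dvd_mult_left dvd_mult_right)
  then show ?thesis by (simp add: residue_delta_def)
qed

text \<open>A single parameter c realises both dilations, because c/n can be given the components
  a/p^e and a'/m. The factor at p ignores the part with denominator m, and the factors at the primes
  dividing m ignore the part with denominator p^e.\<close>

lemma dilates_prod_coprime:
  assumes p: "prime p" and m: "\<not> p dvd m" "m > 0" and n: "n = p ^ e * m"
  shows "(\<lambda>b. local_factor p (of_int (a * b) / of_nat (p ^ e)) *
      (\<Prod>q\<in>prime_factors m. local_factor q (of_int (a' * b) / of_nat m)))
    \<in> dilates (\<lambda>x. local_factor p x * (\<Prod>q\<in>prime_factors m. local_factor q x)) n"
proof -
  have p0: "p > 0" using p by (rule prime_gt_0_nat)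
  have "coprime p m" using p m(1) by (simp add: prime_imp_coprime)
  then have "coprime (int p ^ e) (int m)" by simp
  then obtain x y where xy: "x * int p ^ e + y * int m = 1"
    using bezout_int[of "int p ^ e" "int m"] by (auto simp: coprime_iff_gcd_eq_1)
  \<comment> \<open>By the Bezout relation, c is congruent to a m modulo p^e and to a' p^e modulo
    m.\<close>
  define c where "c = a * int m * (y * int m) + a' * int p ^ e * (x * int p ^ e)"
  have "c - a * int m = int p ^ e * (a' * x * int p ^ e - a * int m * x)"
  proof -
    have "a * int m * (x * int p ^ e + y * int m) = a * int m" by (simp add: xy)
    then show ?thesis unfolding c_def by (simp add: algebra_simps)
  qed
  then obtain u where u: "c - a * int m = int p ^ e * u" by blast
  have "c - a' * int p ^ e = int m * (a * y * int m - a' * int p ^ e * y)"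
  proof -
    have "a' * int p ^ e * (x * int p ^ e + y * int m) = a' * int p ^ e" by (simp add: xy)
    then show ?thesis unfolding c_def by (simp add: algebra_simps)
  qed
  then obtain v where v: "c - a' * int p ^ e = int m * v" by blast
  have "local_factor p (of_int (a * b) / of_nat (p ^ e)) =
      local_factor p (of_int (c * b) / of_nat n)" for b
  proof (rule local_factor_cong)
    show "coprime (int m) (int p)" using \<open>coprime p m\<close> by (simp add: coprime_commute)
    have "c = a * int m + int p ^ e * u" using u by simp
    then have "of_int (int m) * (of_int (a * b) / of_nat (p ^ e) - of_int (c * b) / of_nat n) =
        (of_int (- (u * b)) :: rat)"
      using p0 m(2) by (simp add: n field_simps)
    then show "of_int (int m) * (of_int (a * b) / of_nat (p ^ e) - of_int (c * b) / of_nat n) \<in>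
        (\<int> :: rat set)"
      by (simp only: Ints_of_int)
  qed
  moreover have "local_factor q (of_int (a' * b) / of_nat m) =
      local_factor q (of_int (c * b) / of_nat n)" if q: "q \<in> prime_factors m" for b q
  proof (rule local_factor_cong)
    have "coprime p q"
      using q m p by (metis in_prime_factors_iff prime_imp_coprime primes_dvd_imp_eq)
    then show "coprime (int p ^ e) (int q)" by simp
    have "c = a' * int p ^ e + int m * v" using v by simp
    then have "of_int (int p ^ e) * (of_int (a' * b) / of_nat m - of_int (c * b) / of_nat n) =
        (of_int (- (v * b)) :: rat)"
      using p0 m(2) by (simp add: n field_simps)
    then show "of_int (int p ^ e) * (of_int (a' * b) / of_nat m - of_int (c * b) / of_nat n) \<in>
        (\<int> :: rat set)"
      by (simp only: Ints_of_int)
  qed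
  ultimately show ?thesis by (auto simp: dilates_def)
qed

text \<open>The induction splits off the full power of one prime. A delta modulo n is the product of
  the deltas modulo the two coprime parts, and a product of dilates for the parts is again a dilate.
  For n = 1 the empty product is the constant 1, which is the only delta.\<close>

lemma residue_delta_dilates_prod:
  assumes "n > 0"
  shows "residue_delta (int n) t \<in>
    zspan (int n) (dilates (\<lambda>x. \<Prod>p\<in>prime_factors n. local_factor p x) n)"
  using assms
proof (induction n rule: less_induct)
  case (less n)
  let ?G = "\<lambda>n x. \<Prod>p\<in>prime_factors n. local_factor p x"
  show ?case
  proof (cases "n = 1")
    case True
    then have eq: "residue_delta (int n) t = (\<lambda>b. ?G n (of_int (0 * b) / of_nat n))"
      by (simp add: residue_delta_def fun_eq_iff)
    show ?thesis unfolding eq by (rule zspan.gen[OF dilate_mem])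
  next
    case False
    then obtain p where p: "prime p" "p dvd n" using prime_factor_nat by blast
    define e where "e = multiplicity p n"
    obtain m where n: "n = p ^ e * m" and m: "\<not> p dvd m"
      using multiplicity_decompose'[of n p] less.prems p(1) unfolding e_def
      by (metis not_prime_unit not_gr_zero)
    have e: "e > 0" using p less.prems unfolding e_def by (simp add: prime_multiplicity_gt_zero_iff)
    have m0: "m > 0" using less.prems n by (cases "m = 0") auto
    have p1: "p > 1" using p(1) by (rule prime_gt_1_nat)
    have "1 < p ^ e" using p1 e by (rule one_less_power)
    then have "m < n" using n m0 by simp
    have factors: "?G n x = local_factor p x * ?G m x" for x
    proof -
      have "prime_factors n = insert p (prime_factors m)"
        using n m0 p1 e p(1) by (auto simp: prime_factors_product prime_factorization_prime_power)
      moreover have "p \<notin> prime_factors m" using m by auto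
      ultimately show ?thesis by simp
    qed
    have "(\<lambda>b. residue_delta (int p ^ e) t b * residue_delta (int m) t b) \<in>
        zspan (int n) (dilates (?G n) n)"
    proof (rule zspan_mult[OF prime_power_residue_delta[OF p(1)] less.IH[OF \<open>m < n\<close> m0]])
      show "int p dvd int n" using p(2) by simp
      show "int m dvd int n" using n by simp
      fix f h assume "f \<in> dilates (local_factor p) (p ^ e)" "h \<in> dilates (?G m) m"
      then obtain a a' where "f = (\<lambda>b. local_factor p (of_int (a * b) / of_nat (p ^ e)))"
        and "h = (\<lambda>b. ?G m (of_int (a' * b) / of_nat m))"
        by (auto simp: dilates_def)
      then show "(\<lambda>x. f x * h x) \<in> zspan (int n) (dilates (?G n) n)"
        unfolding factors using dilates_prod_coprime[OF p(1) m m0 n, of a a'] by (simp add: zspan.gen)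
    qed
    moreover have "coprime (int p ^ e) (int m)"
      using p(1) m by (simp add: prime_imp_coprime)
    ultimately show ?thesis
      using residue_delta_mult[of "int p ^ e" "int m" t] n by (simp add: fun_eq_iff cong del: if_weak_cong)
  qed
qed

lemma residue_delta_dilates_duality_kernel:
  assumes "n > 0"
  shows "residue_delta (int n) t \<in> zspan (int n) (dilates duality_kernel n)"
proof -
  have eq: "(\<Prod>p\<in>prime_factors n. local_factor p (of_int z / of_nat n)) = duality_kernel (of_int z / of_nat n)" for z
    using assms by (subst duality_kernel_eq_prod[of n]) auto
  have "dilates (\<lambda>x. \<Prod>p\<in>prime_factors n. local_factor p x) n = dilates duality_kernel n"
    unfolding dilates_def eq ..
  then show ?thesis using residue_delta_dilates_prod[OF assms, of t] by simp
qed

section \<open>Pairings of finite abelian groups\<close>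

text \<open>The convolution product of \<open>\<delta>_0 - \<delta>_(n/p)\<close> over the primes \<open>p\<close> in the list.\<close>

primrec sieve :: "nat \<Rightarrow> nat list \<Rightarrow> int \<Rightarrow> int" where
  "sieve n [] b = residue_delta (int n) 0 b"
| "sieve n (p # ps) b = sieve n ps b - sieve n ps (b - int (n div p))"

lemma sieve_cong:
  "int n dvd b - b' \<Longrightarrow> sieve n ps b = sieve n ps b'"
proof (induction ps arbitrary: b b')
  case Nil
  then have "int n dvd b \<longleftrightarrow> int n dvd b'" by (metis dvd_diff_commute dvd_diff_right_iff)
  then show ?case by (simp add: residue_delta_def)
next
  case (Cons p ps)
  from Cons.IH[of b b'] Cons.IH[of "b - int (n div p)" "b' - int (n div p)"] Cons.prems
  show ?case by simp
qed

text \<open>Each convolution factor moves the support by 0 or n/p, and both are killed by p modulo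
  n.\<close>

lemma sieve_support:
  "\<lbrakk>sieve n ps c \<noteq> 0; \<forall>p\<in>set ps. p dvd n\<rbrakk> \<Longrightarrow> int n dvd int (prod_list ps) * c"
proof (induction ps arbitrary: c)
  case Nil
  then show ?case by (simp add: residue_delta_def)
next
  case (Cons p ps)
  consider "sieve n ps c \<noteq> 0" | "sieve n ps (c - int (n div p)) \<noteq> 0"
    using Cons.prems(1) by fastforce
  then show ?case
  proof cases
    case 1
    then show ?thesis using Cons by (simp add: mult.assoc dvd_mult)
  next
    case 2
    then have "int n dvd int (prod_list ps) * (c - int (n div p))"
      using Cons.prems(2) by (intro Cons.IH) simp_all
    then have "int n dvd int p * (int (prod_list ps) * (c - int (n div p)))"
      by (rule dvd_mult)
    moreover have "int p * int (n div p) = int n"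
      using Cons.prems(2) by (metis dvd_mult_div_cancel list.set_intros(1) of_nat_mult)
    then have "int (prod_list (p # ps)) * c =
        int p * (int (prod_list ps) * (c - int (n div p))) + int n * int (prod_list ps)"
      by (simp add: algebra_simps)
    ultimately show ?thesis by simp
  qed
qed

text \<open>The shifted term vanishes: by \<open>sieve_support\<close> it could be nonzero only if
  n/p were killed modulo n by the product of the remaining primes, which p does not divide.\<close>

lemma sieve_0:
  "\<lbrakk>n > 0; distinct ps; \<forall>p\<in>set ps. prime p \<and> p dvd n\<rbrakk> \<Longrightarrow> sieve n ps 0 = 1"
proof (induction ps)
  case Nil
  then show ?case by (simp add: residue_delta_def)
next
  case (Cons p ps)
  have "sieve n ps (0 - int (n div p)) = 0"
  proof (rule ccontr)
    assume "\<not> ?thesis"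
    from sieve_support[OF this] Cons.prems
    have "int n dvd int (prod_list ps) * int (n div p)" by simp
    then have "n dvd prod_list ps * (n div p)" by (metis of_nat_dvd_iff of_nat_mult)
    moreover have n: "n = p * (n div p)" using Cons.prems by simp
    moreover have "n div p > 0" using Cons.prems n by (metis mult_0_right not_gr_zero)
    ultimately have "p dvd prod_list ps" by (metis dvd_times_right_cancel_iff not_gr_zero)
    moreover have "\<exists>q\<in>set qs. p dvd q" if "p dvd prod_list qs" for qs
      using that Cons.prems(3) by (induction qs) (auto simp: prime_dvd_mult_iff)
    ultimately obtain q where "q \<in> set ps" "p dvd q" by blast
    then show False using Cons.prems by (metis distinct.simps(2) list.set_intros primes_dvd_imp_eq)
  qed
  then show ?case using Cons by simp
qed

lemma sieve_in_zspan:
  assumes "n > 0"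
  shows "(\<lambda>b. sieve n ps (b - c)) \<in> zspan (int n) (dilates duality_kernel n)"
proof (induction ps arbitrary: c)
  case Nil
  have "(\<lambda>b. sieve n [] (b - c)) = residue_delta (int n) c"
    by (simp add: residue_delta_def fun_eq_iff)
  then show ?case using residue_delta_dilates_duality_kernel[OF assms] by simp
next
  case (Cons p ps)
  show ?case using zspan_diff[OF Cons.IH[of c] Cons.IH[of "c + int (n div p)"]]
    by (simp add: diff_diff_eq)
qed

text \<open>This is Cauchy's theorem for the subgroup of \<int>/n generated by z: it is nontrivial,
  so for a prime p dividing its order it contains n/p, an element of order p.\<close>

lemma prime_factor_multiple:
  assumes "n > 0" "\<not> int n dvd z"
  obtains p k where "prime p" "p dvd n" "int n dvd int k * z - int (n div p)"
proof -
  define g where "g = gcd z (int n)"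
  have g: "g > 0" "g dvd int n" using assms(1) by (auto simp: g_def)
  obtain h where h: "int n = g * h" using g by blast
  have "h > 0" using g(1) h assms(1) by (metis of_nat_0_less_iff zero_less_mult_pos)
  have "h \<noteq> 1" using h assms(2) by (metis g_def gcd_dvd1 mult.right_neutral)
  then obtain q where q: "prime q" "q dvd nat h"
    using \<open>h > 0\<close> prime_factor_nat[of "nat h"] by (auto simp: nat_eq_iff)
  obtain t where t: "h = int q * t" using q(2) \<open>h > 0\<close> by (metis dvd_def int_dvd_int_iff int_nat_eq less_imp_le)
  have nq: "int n = int q * (g * t)" using h t by simp
  have q0: "q > 0" using q(1) by (rule prime_gt_0_nat)
  have div: "int (n div q) = g * t" using nq q0 by (simp add: zdiv_int)
  obtain u w where uw: "u * z + w * int n = g" using bezout_int unfolding g_def by blast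
  \<comment> \<open>As u z is congruent to the gcd g modulo n, the multiple u t z is congruent to g
    t = n/q. Reducing u t modulo n makes it a natural number, usable as an exponent in a
    group.\<close>
  define k where "k = nat ((u * t) mod int n)"
  have k: "int n dvd int k - u * t"
    using assms(1) unfolding k_def by (simp add: mod_eq_dvd_iff flip: mod_eq_dvd_iff)
  have "int k * z - int (n div q) = (int k - u * t) * z - int n * (w * t)"
    unfolding div uw[symmetric] by (simp add: algebra_simps)
  then have "int n dvd int k * z - int (n div q)" using k by simp
  moreover have "q dvd n" using nq by (metis dvd_triv_left int_dvd_int_iff)
  ultimately show thesis using that q(1) by blast
qed

section \<open>Sums of the sieve along homomorphisms to the integers modulo n\<close>

context comm_group
begin

lemma sum_translate:
  assumes "x0 \<in> carrier G"
  shows "(\<Sum>x\<in>carrier G. f (x \<otimes> x0)) = (\<Sum>x\<in>carrier G. f x)"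
  by (rule sum.reindex_bij_witness[of _ "\<lambda>x. x \<otimes> inv x0" "\<lambda>x. x \<otimes> x0"])
     (auto simp: assms m_assoc)

text \<open>When the head of the list is p, the sum is a difference of two sums whose arguments are
  shifted by n/p against each other. Translating the group by \<open>x0\<close> identifies them. For
  any other head, both sums vanish by induction.\<close>

lemma sum_sieve_eq_0:
  assumes add: "\<And>x y. \<lbrakk>x \<in> carrier G; y \<in> carrier G\<rbrakk> \<Longrightarrow> int n dvd f (x \<otimes> y) - (f x + f y)"
    and x0: "x0 \<in> carrier G" "int n dvd f x0 - int (n div p)"
  shows "p \<in> set ps \<Longrightarrow> (\<Sum>x\<in>carrier G. sieve n ps (f x + c)) = 0"
proof (induction ps arbitrary: c)
  case (Cons q ps)
  have split: "(\<Sum>x\<in>carrier G. sieve n (q # ps) (f x + c)) =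
      (\<Sum>x\<in>carrier G. sieve n ps (f x + c)) - (\<Sum>x\<in>carrier G. sieve n ps (f x + (c - int (n div q))))"
    by (simp add: sum_subtractf add_diff_eq)
  show ?case
  proof (cases "p = q")
    case True
    have "sieve n ps (f (x \<otimes> x0) + (c - int (n div q))) = sieve n ps (f x + c)"
      if "x \<in> carrier G" for x
    proof (rule sieve_cong)
      have "int n dvd (f (x \<otimes> x0) - (f x + f x0)) + (f x0 - int (n div p))"
        using add[OF that x0(1)] x0(2) by (rule dvd_add)
      then show "int n dvd f (x \<otimes> x0) + (c - int (n div q)) - (f x + c)"
        using True by (simp add: algebra_simps)
    qed
    then show ?thesis
      unfolding split
      using sum_translate[OF x0(1), of "\<lambda>x. sieve n ps (f x + (c - int (n div q)))"] by simp
  next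
    case False
    then show ?thesis using Cons unfolding split by simp
  qed
qed simp

lemma additive_mod_one:
  assumes "\<And>x y. \<lbrakk>x \<in> carrier G; y \<in> carrier G\<rbrakk> \<Longrightarrow> int n dvd f (x \<otimes> y) - (f x + f y)"
  shows "int n dvd f \<one>"
  using assms[of \<one> \<one>] by simp

lemma additive_mod_pow:
  assumes add: "\<And>x y. \<lbrakk>x \<in> carrier G; y \<in> carrier G\<rbrakk> \<Longrightarrow> int n dvd f (x \<otimes> y) - (f x + f y)"
    and x: "x \<in> carrier G"
  shows "int n dvd f (x [^] (k::nat)) - int k * f x"
proof (induction k)
  case 0
  then show ?case using additive_mod_one[of n f, OF add] by simp
next
  case (Suc k)
  have "int n dvd (f (x [^] k \<otimes> x) - (f (x [^] k) + f x)) + (f (x [^] k) - int k * f x)"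
    by (rule dvd_add[OF add Suc.IH]) (use x in auto)
  then show ?case by (simp add: algebra_simps)
qed

text \<open>If some value of f is nonzero modulo n, a power of the corresponding element has value
  n/p for a prime p dividing n, and the convolution factor at p kills the sum. Otherwise every term
  is \<open>sieve n ps 0\<close>, which is 1.\<close>

lemma sum_sieve:
  assumes fin: "finite (carrier G)" and n: "n > 0"
    and add: "\<And>x y. \<lbrakk>x \<in> carrier G; y \<in> carrier G\<rbrakk> \<Longrightarrow> int n dvd f (x \<otimes> y) - (f x + f y)"
    and ps: "distinct ps" "set ps = prime_factors n"
  shows "(\<Sum>x\<in>carrier G. sieve n ps (f x)) =
    (if \<forall>x\<in>carrier G. int n dvd f x then int (order G) else 0)"
proof (cases "\<forall>x\<in>carrier G. int n dvd f x")
  case True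
  have "sieve n ps 0 = 1" using n ps by (intro sieve_0) auto
  then have "sieve n ps (f x) = 1" if "x \<in> carrier G" for x
    using sieve_cong[of n "f x" 0 ps] True that by simp
  then show ?thesis using True by (simp add: order_def)
next
  case False
  then obtain y where y: "y \<in> carrier G" "\<not> int n dvd f y" by blast
  obtain p k where p: "prime p" "p dvd n" "int n dvd int k * f y - int (n div p)"
    using prime_factor_multiple[OF n y(2)] by blast
  have "int n dvd (f (y [^] k) - int k * f y) + (int k * f y - int (n div p))"
    by (rule dvd_add[OF additive_mod_pow[OF add y(1)] p(3)])
  then have "int n dvd f (y [^] k) - int (n div p)" by simp
  moreover have "p \<in> set ps" using p n ps(2) by (auto simp: in_prime_factors_iff)
  ultimately show ?thesis
    using sum_sieve_eq_0[of n f "y [^] k" p ps 0, OF add] y False by (subst if_not_P) simp_all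
qed

end

text \<open>A nondegenerate pairing with values in \<int>/n, given by integer representatives;
  bilinearity therefore holds only modulo \<open>n\<close>. Its symmetric form allows one argument
  to serve for both rows and columns.\<close>

locale residue_pairing =
  fixes G :: "('a, 'p) monoid_scheme" and H :: "('b, 'q) monoid_scheme"
    and n :: nat and \<beta> :: "'a \<Rightarrow> 'b \<Rightarrow> int"
  assumes comm_group_left: "comm_group G" and comm_group_right: "comm_group H"
    and finite_left: "finite (carrier G)" and finite_right: "finite (carrier H)"
    and n_pos: "n > 0"
    and mult_left: "\<lbrakk>x \<in> carrier G; x' \<in> carrier G; y \<in> carrier H\<rbrakk>
      \<Longrightarrow> int n dvd \<beta> (x \<otimes>\<^bsub>G\<^esub> x') y - (\<beta> x y + \<beta> x' y)"
    and mult_right: "\<lbrakk>x \<in> carrier G; y \<in> carrier H; y' \<in> carrier H\<rbrakk>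
      \<Longrightarrow> int n dvd \<beta> x (y \<otimes>\<^bsub>H\<^esub> y') - (\<beta> x y + \<beta> x y')"
    and nondegenerate_left:
      "\<lbrakk>x \<in> carrier G; \<And>y. y \<in> carrier H \<Longrightarrow> int n dvd \<beta> x y\<rbrakk> \<Longrightarrow> x = \<one>\<^bsub>G\<^esub>"
    and nondegenerate_right:
      "\<lbrakk>y \<in> carrier H; \<And>x. x \<in> carrier G \<Longrightarrow> int n dvd \<beta> x y\<rbrakk> \<Longrightarrow> y = \<one>\<^bsub>H\<^esub>"
begin

interpretation G: comm_group G by (rule comm_group_left)
interpretation H: comm_group H by (rule comm_group_right)

lemma flip: "residue_pairing H G n (\<lambda>y x. \<beta> x y)"
  by unfold_locales
     (auto intro: finite_left finite_right n_pos mult_left mult_right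
       nondegenerate_left nondegenerate_right)

lemma one_left: "y \<in> carrier H \<Longrightarrow> int n dvd \<beta> \<one>\<^bsub>G\<^esub> y"
  by (rule G.additive_mod_one) (rule mult_left)

lemma one_right: "x \<in> carrier G \<Longrightarrow> int n dvd \<beta> x \<one>\<^bsub>H\<^esub>"
  by (rule H.additive_mod_one) (rule mult_right)

text \<open>Double counting: the sum of the sieve of \<beta>(x, y) over all pairs is the order of H
  if y is summed first and the order of G if x is summed first.\<close>

lemma order_eq: "order G = order H"
proof -
  define ps where "ps = sorted_list_of_set (prime_factors n)"
  have ps: "distinct ps" "set ps = prime_factors n" by (simp_all add: ps_def)
  have "(\<Sum>x\<in>carrier G. \<Sum>y\<in>carrier H. sieve n ps (\<beta> x y)) =
      (\<Sum>x\<in>carrier G. if x = \<one>\<^bsub>G\<^esub> then int (order H) else 0)"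
  proof (rule sum.cong[OF refl])
    fix x assume x: "x \<in> carrier G"
    have "(\<forall>y\<in>carrier H. int n dvd \<beta> x y) \<longleftrightarrow> x = \<one>\<^bsub>G\<^esub>"
      using nondegenerate_left[OF x] one_left by blast
    then show "(\<Sum>y\<in>carrier H. sieve n ps (\<beta> x y)) = (if x = \<one>\<^bsub>G\<^esub> then int (order H) else 0)"
      using H.sum_sieve[OF finite_right n_pos _ ps, of "\<beta> x"] mult_right[OF x] by simp
  qed
  also have "\<dots> = int (order H)" using finite_left by simp
  finally have 1: "(\<Sum>x\<in>carrier G. \<Sum>y\<in>carrier H. sieve n ps (\<beta> x y)) = int (order H)" .
  have "(\<Sum>y\<in>carrier H. \<Sum>x\<in>carrier G. sieve n ps (\<beta> x y)) =
      (\<Sum>y\<in>carrier H. if y = \<one>\<^bsub>H\<^esub> then int (order G) else 0)"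
  proof (rule sum.cong[OF refl])
    fix y assume y: "y \<in> carrier H"
    have "(\<forall>x\<in>carrier G. int n dvd \<beta> x y) \<longleftrightarrow> y = \<one>\<^bsub>H\<^esub>"
      using nondegenerate_right[OF y] one_right by blast
    then show "(\<Sum>x\<in>carrier G. sieve n ps (\<beta> x y)) = (if y = \<one>\<^bsub>H\<^esub> then int (order G) else 0)"
      using G.sum_sieve[OF finite_left n_pos _ ps, of "\<lambda>x. \<beta> x y"] mult_left[OF _ _ y] by simp
  qed
  also have "\<dots> = int (order G)" using finite_right by simp
  finally have "(\<Sum>y\<in>carrier H. \<Sum>x\<in>carrier G. sieve n ps (\<beta> x y)) = int (order G)" .
  then show ?thesis using 1 sum.swap[of "\<lambda>x y. sieve n ps (\<beta> x y)" "carrier H" "carrier G"] by simp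
qed

lemma left_eqI:
  assumes x: "x \<in> carrier G" "t \<in> carrier G"
    and eq: "\<And>y. y \<in> carrier H \<Longrightarrow> int n dvd \<beta> x y - \<beta> t y"
  shows "x = t"
proof -
  have "int n dvd \<beta> (x \<otimes>\<^bsub>G\<^esub> inv\<^bsub>G\<^esub> t) y" if y: "y \<in> carrier H" for y
  proof -
    have "int n dvd (\<beta> x y - \<beta> t y) -
        (\<beta> (x \<otimes>\<^bsub>G\<^esub> inv\<^bsub>G\<^esub> t \<otimes>\<^bsub>G\<^esub> t) y - (\<beta> (x \<otimes>\<^bsub>G\<^esub> inv\<^bsub>G\<^esub> t) y + \<beta> t y))"
      using x y by (intro dvd_diff eq mult_left) auto
    then show ?thesis using x by (simp add: G.m_assoc)
  qed
  then have "x \<otimes>\<^bsub>G\<^esub> inv\<^bsub>G\<^esub> t = \<one>\<^bsub>G\<^esub>" using x by (intro nondegenerate_left) auto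
  then show ?thesis using x by (metis G.inv_equality G.inv_inv G.inv_closed)
qed

text \<open>Bilinearity absorbs the dilation into the second argument: w is a power of y whose
  exponent is a natural number congruent to a modulo n.\<close>

lemma duality_kernel_multiple:
  assumes "y \<in> carrier H"
  shows "\<exists>w\<in>carrier H. \<forall>x\<in>carrier G.
    duality_kernel (of_int (a * \<beta> x y) / of_nat n) = duality_kernel (of_int (\<beta> x w) / of_nat n)"
proof (intro bexI ballI)
  define k where "k = nat (a mod int n)"
  show "y [^]\<^bsub>H\<^esub> k \<in> carrier H" using assms by simp
  fix x assume x: "x \<in> carrier G"
  have "a - int k = int n * (a div int n)"
    using n_pos by (simp add: k_def minus_mod_eq_mult_div)
  then have "int n dvd a - int k" by simp
  then have "int n dvd (a - int k) * \<beta> x y - (\<beta> x (y [^]\<^bsub>H\<^esub> k) - int k * \<beta> x y)"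
    by (intro dvd_diff H.additive_mod_pow mult_right x assms) simp_all
  then have "int n dvd a * \<beta> x y - \<beta> x (y [^]\<^bsub>H\<^esub> k)" by (simp add: algebra_simps)
  then obtain z where "a * \<beta> x y - \<beta> x (y [^]\<^bsub>H\<^esub> k) = int n * z" by blast
  then have z: "a * \<beta> x y = \<beta> x (y [^]\<^bsub>H\<^esub> k) + int n * z" by simp
  have "of_int (a * \<beta> x y) / of_nat n - of_int (\<beta> x (y [^]\<^bsub>H\<^esub> k)) / of_nat n = (of_int z :: rat)"
    using n_pos unfolding z by (simp add: field_simps)
  then show "duality_kernel (of_int (a * \<beta> x y) / of_nat n) =
      duality_kernel (of_int (\<beta> x (y [^]\<^bsub>H\<^esub> k)) / of_nat n)"
    by (intro duality_kernel_cong) (simp only: Ints_of_int)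
qed

lemma duality_kernel_matrix_span:
  assumes n: "n = order H" and t: "t \<in> carrier G"
  shows "\<exists>r a. \<forall>x\<in>carrier G. int n ^ r * of_bool (x = t) =
    (\<Sum>y\<in>carrier H. a y * duality_kernel (of_int (\<beta> x y) / of_nat n))"
proof -
  define ps where "ps = sorted_list_of_set (prime_factors n)"
  have ps: "distinct ps" "set ps = prime_factors n" by (simp_all add: ps_def)
  \<comment> \<open>Elements of a \<open>zspan\<close> are total functions, while the pairing is
    controlled only on the carrier. The cutoff \<chi> turns agreement on the carrier into equality
    of functions.\<close>
  define \<chi> :: "'a \<Rightarrow> int" where "\<chi> = (\<lambda>x. of_bool (x \<in> carrier G))"
  define K where "K = (\<lambda>y x. duality_kernel (of_int (\<beta> x y) / of_nat n) * \<chi> x)"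
  let ?S = "zspan (int n) (K ` carrier H)"
  have S: "(\<lambda>x. sieve n ps (\<beta> x y - \<beta> t y) * \<chi> x) \<in> ?S" if y: "y \<in> carrier H" for y
  proof (rule zspan_mult_right[OF _ dvd_refl])
    let ?D = "range (\<lambda>a x. duality_kernel (of_int (a * \<beta> x y) / of_nat n))"
    show "(\<lambda>x. sieve n ps (\<beta> x y - \<beta> t y)) \<in> zspan (int n) ?D"
      by (rule zspan_comp[OF sieve_in_zspan[OF n_pos]])
         (auto simp: dilates_def intro!: zspan.gen)
    fix b assume "b \<in> ?D"
    then obtain a where b: "b = (\<lambda>x. duality_kernel (of_int (a * \<beta> x y) / of_nat n))" by blast
    from duality_kernel_multiple[OF y, of a] obtain w where w: "w \<in> carrier H"
      "\<forall>x\<in>carrier G. duality_kernel (of_int (a * \<beta> x y) / of_nat n) =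
        duality_kernel (of_int (\<beta> x w) / of_nat n)" by blast
    then have "(\<lambda>x. b x * \<chi> x) = K w" unfolding b K_def \<chi>_def by (auto simp: fun_eq_iff)
    then show "(\<lambda>x. b x * \<chi> x) \<in> ?S" using w(1) by (auto intro: zspan.gen)
  qed
  have "(\<lambda>x. \<Sum>y\<in>carrier H. sieve n ps (\<beta> x y - \<beta> t y) * \<chi> x) \<in> ?S"
    by (rule zspan_sum) (rule S)
  \<comment> \<open>Here y \<mapsto> \<beta>(x, y) - \<beta>(t, y) is additive modulo n, and by
    nondegeneracy it is zero only for x = t. The resulting factor is the order of H; as this is n,
    the span allows division by it.\<close>
  moreover have "(\<Sum>y\<in>carrier H. sieve n ps (\<beta> x y - \<beta> t y) * \<chi> x) =
      int n * (of_bool (x = t) * \<chi> x)" for x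
  proof (cases "x \<in> carrier G")
    case True
    have "int n dvd (\<beta> x (y \<otimes>\<^bsub>H\<^esub> y') - \<beta> t (y \<otimes>\<^bsub>H\<^esub> y')) - ((\<beta> x y - \<beta> t y) + (\<beta> x y' - \<beta> t y'))"
      if "y \<in> carrier H" "y' \<in> carrier H" for y y'
    proof -
      have "int n dvd (\<beta> x (y \<otimes>\<^bsub>H\<^esub> y') - (\<beta> x y + \<beta> x y')) - (\<beta> t (y \<otimes>\<^bsub>H\<^esub> y') - (\<beta> t y + \<beta> t y'))"
        using that True t by (intro dvd_diff mult_right)
      then show ?thesis by (simp add: algebra_simps)
    qed
    from H.sum_sieve[OF finite_right n_pos this ps]
    have "(\<Sum>y\<in>carrier H. sieve n ps (\<beta> x y - \<beta> t y)) =
        (if \<forall>y\<in>carrier H. int n dvd \<beta> x y - \<beta> t y then int (order H) else 0)" by simp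
    moreover have "(\<forall>y\<in>carrier H. int n dvd \<beta> x y - \<beta> t y) \<longleftrightarrow> x = t"
      using left_eqI[OF True t] by auto
    ultimately show ?thesis using True n by (simp add: \<chi>_def)
  qed (simp add: \<chi>_def)
  ultimately have "(\<lambda>x. int n * (of_bool (x = t) * \<chi> x)) \<in> ?S" by simp
  then have "(\<lambda>x. of_bool (x = t) * \<chi> x) \<in> ?S" by (rule zspan.divide)
  from zspan_linear_combination[OF this finite_right] obtain r a where
    ra: "\<And>x. int n ^ r * (of_bool (x = t) * \<chi> x) = (\<Sum>y\<in>carrier H. a y * K y x)" by blast
  have "int n ^ r * of_bool (x = t) =
      (\<Sum>y\<in>carrier H. a y * duality_kernel (of_int (\<beta> x y) / of_nat n))" if "x \<in> carrier G" for x
    using ra[of x] that by (simp add: \<chi>_def K_def)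
  then show ?thesis by blast
qed

end

section \<open>The dual of a finite abelian group\<close>

definition rat_class :: "rat \<Rightarrow> rat set"
  where "rat_class q = \<int> #>\<^bsub>rat_group\<^esub> q"

lemma comm_group_rat_group: "comm_group rat_group"
  by (rule comm_groupI) (auto simp: rat_group_def intro: exI[of _ "- _"])

lemma subgroup_Ints: "subgroup \<int> rat_group"
proof -
  interpret comm_group rat_group by (rule comm_group_rat_group)
  have "inv\<^bsub>rat_group\<^esub> q = - q" for q
    by (rule inv_equality) (auto simp: rat_group_def)
  then show ?thesis by unfold_locales (auto simp: rat_group_def)
qed

lemma rat_class_eq: "rat_class q = {r. r - q \<in> \<int>}"
proof -
  have "r \<in> rat_class q \<longleftrightarrow> r - q \<in> \<int>" for r
  proof -
    have "r \<in> rat_class q \<longleftrightarrow> (\<exists>z\<in>\<int>. r = z + q)"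
      by (auto simp: rat_class_def r_coset_def rat_group_def)
    also have "\<dots> \<longleftrightarrow> r - q \<in> \<int>" by (metis add_diff_cancel diff_add_cancel)
    finally show ?thesis .
  qed
  then show ?thesis by blast
qed

lemma rat_class_eq_iff: "rat_class q = rat_class r \<longleftrightarrow> q - r \<in> \<int>"
proof
  assume "rat_class q = rat_class r"
  moreover have "q \<in> rat_class q" by (simp add: rat_class_eq)
  ultimately show "q - r \<in> \<int>" by (simp add: rat_class_eq)
next
  assume qr: "q - r \<in> \<int>"
  have "s - q \<in> \<int> \<longleftrightarrow> s - r \<in> \<int>" for s
    using Ints_add[OF _ qr, of "s - q"] Ints_diff[OF _ qr, of "s - r"] by auto
  then show "rat_class q = rat_class r" by (simp add: rat_class_eq)
qed

text \<open>The dictionary between the n-torsion of \<rat>/\<int> and the integers modulo n.\<close>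

lemma rat_class_fraction_eq_iff:
  assumes "n > 0"
  shows "rat_class (of_int a / of_nat n) = rat_class (of_int b / of_nat n) \<longleftrightarrow> int n dvd a - b"
proof -
  have "of_int a / of_nat n - of_int b / of_nat n = (of_int z :: rat) \<longleftrightarrow> a - b = int n * z" for z
  proof -
    have "of_int a / of_nat n - of_int b / of_nat n = (of_int z :: rat) \<longleftrightarrow>
        (of_int (a - b) :: rat) = of_int (int n * z)"
      using assms by (simp add: field_simps)
    then show ?thesis unfolding of_int_eq_iff .
  qed
  then show ?thesis unfolding rat_class_eq_iff Ints_def dvd_def by blast
qed

lemma carrier_rat_mod_int: "carrier rat_mod_int = range rat_class"
  by (auto simp: rat_mod_int_def carrier_FactGroup rat_class_def rat_group_def)

lemma normal_Ints: "\<int> \<lhd> rat_group"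
  using comm_group.subgroup_imp_normal[OF comm_group_rat_group subgroup_Ints] .

lemma rat_class_mult: "rat_class q \<otimes>\<^bsub>rat_mod_int\<^esub> rat_class r = rat_class (q + r)"
  using normal.rcos_sum[OF normal_Ints, of q r]
  by (simp add: rat_mod_int_def rat_class_def rat_group_def)

lemma one_rat_mod_int: "\<one>\<^bsub>rat_mod_int\<^esub> = rat_class 0"
  unfolding rat_class_eq by (simp add: rat_mod_int_def)

lemma comm_group_rat_mod_int: "comm_group rat_mod_int"
  unfolding rat_mod_int_def
  by (rule comm_group.abelian_FactGroup[OF comm_group_rat_group subgroup_Ints])

lemma rat_class_pow: "rat_class q [^]\<^bsub>rat_mod_int\<^esub> (k::nat) = rat_class (of_nat k * q)"
  by (induction k) (simp_all add: one_rat_mod_int rat_class_mult algebra_simps nat_pow_def)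

text \<open>The descent of \<open>duality_kernel\<close> to cosets; by
  \<open>duality_kernel_cong\<close> the chosen representative does not matter.\<close>

definition class_kernel :: "rat set \<Rightarrow> int"
  where "class_kernel T = duality_kernel (SOME q. q \<in> T)"

lemma class_kernel_rat_class: "class_kernel (rat_class q) = duality_kernel q"
proof -
  have "q \<in> rat_class q" by (simp add: rat_class_eq)
  then have "(SOME r. r \<in> rat_class q) \<in> rat_class q" by (rule someI)
  then show ?thesis
    unfolding class_kernel_def by (intro duality_kernel_cong) (simp add: rat_class_eq)
qed

lemma dual_group_simps:
  "carrier (dual_group V) = hom V rat_mod_int \<inter> extensional (carrier V)"
  "\<phi> \<otimes>\<^bsub>dual_group V\<^esub> \<psi> = (\<lambda>v\<in>carrier V. \<phi> v \<otimes>\<^bsub>rat_mod_int\<^esub> \<psi> v)"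
  "\<one>\<^bsub>dual_group V\<^esub> = (\<lambda>v\<in>carrier V. \<one>\<^bsub>rat_mod_int\<^esub>)"
  by (simp_all add: dual_group_def)

lemma comm_group_dual_group:
  assumes "comm_group V"
  shows "comm_group (dual_group V)"
proof -
  interpret V: comm_group V by (rule assms)
  interpret Q: comm_group rat_mod_int by (rule comm_group_rat_mod_int)
  show ?thesis
  proof (rule comm_groupI, goal_cases)
    case (1 \<phi> \<psi>)
    then show ?case
      by (auto simp: dual_group_simps hom_def Pi_iff Q.m_ac)
  next
    case 2
    then show ?case by (auto simp: dual_group_simps hom_def)
  next
    case (3 \<phi> \<psi> \<chi>)
    then show ?case
      by (auto simp: dual_group_simps fun_eq_iff hom_def Pi_iff Q.m_assoc)
  next
    case (4 \<phi> \<psi>)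
    then show ?case
      by (auto simp: dual_group_simps fun_eq_iff hom_def Pi_iff Q.m_comm)
  next
    case (5 \<phi>)
    then show ?case
      by (auto simp: dual_group_simps fun_eq_iff hom_def Pi_iff extensional_def)
  next
    case (6 \<phi>)
    then have "(\<lambda>v\<in>carrier V. inv\<^bsub>rat_mod_int\<^esub> \<phi> v) \<in> carrier (dual_group V)"
      by (auto simp: dual_group_simps hom_def Pi_iff Q.inv_mult)
    moreover have "(\<lambda>v\<in>carrier V. inv\<^bsub>rat_mod_int\<^esub> \<phi> v) \<otimes>\<^bsub>dual_group V\<^esub> \<phi> = \<one>\<^bsub>dual_group V\<^esub>"
      using 6 by (auto simp: dual_group_simps fun_eq_iff hom_def Pi_iff)
    ultimately show ?case by blast
  qed
qed

text \<open>A numerator of \<phi>(v) over the denominator \<open>n\<close>. It is an arbitrary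
  choice, determined and additive only modulo \<open>n\<close>.\<close>

definition dual_residue :: "nat \<Rightarrow> ('a \<Rightarrow> rat set) \<Rightarrow> 'a \<Rightarrow> int"
  where "dual_residue n \<phi> v = (SOME b. \<phi> v = rat_class (of_int b / of_nat n))"

text \<open>The n-th power of v is trivial, so n kills \<phi>(v), which therefore has a
  representative with denominator n.\<close>

lemma rat_class_dual_residue:
  assumes "comm_group V" "finite (carrier V)" and n: "n = order V"
    and \<phi>: "\<phi> \<in> carrier (dual_group V)" and v: "v \<in> carrier V"
  shows "\<phi> v = rat_class (of_int (dual_residue n \<phi> v) / of_nat n)"
proof -
  interpret V: comm_group V by (rule assms)
  interpret Q: comm_group rat_mod_int by (rule comm_group_rat_mod_int)
  interpret \<phi>: group_hom V rat_mod_int \<phi>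
    using \<phi> by unfold_locales (simp add: dual_group_simps)
  have n0: "n > 0" using n assms(2) V.order_gt_0_iff_finite by blast
  obtain q where q: "\<phi> v = rat_class q"
    using \<phi>.hom_closed[OF v] by (auto simp: carrier_rat_mod_int)
  have "rat_class (of_nat n * q) = \<phi> v [^]\<^bsub>rat_mod_int\<^esub> n" by (simp add: q rat_class_pow)
  also have "\<dots> = \<phi> (v [^]\<^bsub>V\<^esub> n)" using v by (simp add: \<phi>.hom_nat_pow)
  also have "v [^]\<^bsub>V\<^esub> n = \<one>\<^bsub>V\<^esub>" using v n by (simp add: V.pow_order_eq_1)
  finally have "rat_class (of_nat n * q) = rat_class 0" by (simp add: one_rat_mod_int)
  then obtain b where "of_nat n * q = of_int b" by (auto simp: rat_class_eq_iff Ints_def)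
  then have "q = of_int b / of_nat n" using n0 by (simp add: field_simps)
  then have "\<phi> v = rat_class (of_int b / of_nat n)" using q by simp
  then show ?thesis unfolding dual_residue_def by (rule someI)
qed

lemma finite_dual_group:
  assumes "comm_group V" "finite (carrier V)"
  shows "finite (carrier (dual_group V))"
proof -
  interpret V: comm_group V by (rule assms)
  define n where "n = order V"
  have n0: "n > 0" using assms(2) V.order_gt_0_iff_finite unfolding n_def by blast
  let ?T = "(\<lambda>b. rat_class (of_int b / of_nat n)) ` {0..<int n}"
  have "carrier (dual_group V) \<subseteq> carrier V \<rightarrow>\<^sub>E ?T"
  proof
    fix \<phi> assume \<phi>: "\<phi> \<in> carrier (dual_group V)"
    have "\<phi> v \<in> ?T" if v: "v \<in> carrier V" for v
    proof
      let ?b = "dual_residue n \<phi> v"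
      show "?b mod int n \<in> {0..<int n}" using n0 by simp
      have "int n dvd ?b - ?b mod int n" by (simp add: minus_mod_eq_mult_div)
      then show "\<phi> v = rat_class (of_int (?b mod int n) / of_nat n)"
        using rat_class_dual_residue[OF assms n_def \<phi> v] n0
        by (simp add: rat_class_fraction_eq_iff)
    qed
    then show "\<phi> \<in> carrier V \<rightarrow>\<^sub>E ?T" using \<phi> by (auto simp: dual_group_simps extensional_def)
  qed
  then show ?thesis using assms(2) by (meson finite_PiE finite_atLeastLessThan_int finite_imageI finite_subset)
qed

text \<open>A homomorphism from \<open>H\<close> to \<int>/n in terms of integer representatives,
  which turns the extension of characters into divisibility statements.\<close>

definition additive_mod_on :: "('a, 'p) monoid_scheme \<Rightarrow> nat \<Rightarrow> 'a set \<Rightarrow> ('a \<Rightarrow> int) \<Rightarrow> bool"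
  where "additive_mod_on G n H f \<longleftrightarrow> (\<forall>a\<in>H. \<forall>b\<in>H. int n dvd f (a \<otimes>\<^bsub>G\<^esub> b) - (f a + f b))"

section \<open>Extension of characters from subgroups\<close>

context comm_group
begin

lemma additive_mod_on_int_pow:
  assumes f: "additive_mod_on G n H f" and H: "subgroup H G" and g: "g \<in> H"
  shows "int n dvd f (g [^] (c::int)) - c * f g"
proof -
  have gc: "g \<in> carrier G" using g H by (rule subgroup.mem_carrier[rotated])
  have pow: "g [^] i \<in> H" for i :: int using g H by (simp add: subgroup_int_pow_closed)
  have add: "int n dvd f (a \<otimes> b) - (f a + f b)" if "a \<in> H" "b \<in> H" for a b
    using f that by (simp add: additive_mod_on_def)
  have one: "int n dvd f \<one>"
    using add[of \<one> \<one>] subgroup.one_closed[OF H] by simp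
  have nat: "int n dvd f (g [^] int k) - int k * f g" for k
  proof (induction k)
    case 0
    then show ?case using one by simp
  next
    case (Suc k)
    have "int n dvd (f (g [^] int k \<otimes> g) - (f (g [^] int k) + f g)) + (f (g [^] int k) - int k * f g)"
      by (rule dvd_add[OF add Suc.IH]) (use pow g in auto)
    moreover have "g [^] int k \<otimes> g = g [^] int (Suc k)"
      unfolding int_pow_int by simp
    ultimately show ?case by (simp add: algebra_simps)
  qed
  show ?thesis
  proof (cases "c \<ge> 0")
    case True
    then show ?thesis using nat[of "nat c"] by simp
  next
    case False
    define k where "k = nat (- c)"
    have c: "c = - int k" using False by (simp add: k_def)
    have "g [^] int k \<otimes> g [^] c = \<one>" using gc unfolding c by (simp add: int_pow_neg)
    then have "int n dvd f \<one> - (f (g [^] int k) + f (g [^] c))"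
      using add[OF pow pow, of "int k" c] by simp
    from dvd_diff[OF dvd_diff[OF one this] nat[of k]]
    have "int n dvd f (g [^] c) + int k * f g" by simp
    then show ?thesis by (simp add: c)
  qed
qed

text \<open>The extension to the subgroup generated by H and x sends h x^i to f(h) + i y. The powers
  of x lying in H are the powers of x^m, so the congruence between m y and f(x^m) is exactly the
  condition for consistency.\<close>

lemma extend_additive_mod:
  assumes H: "subgroup H G" and f: "additive_mod_on G n H f" and x: "x \<in> carrier G"
    and m: "\<And>i::int. x [^] i \<in> H \<longleftrightarrow> int m dvd i"
    and y: "int n dvd int m * y - f (x [^] int m)"
  obtains H' f' where "subgroup H' G" "H \<subseteq> H'" "x \<in> H'" "additive_mod_on G n H' f'"
    "\<And>h. h \<in> H \<Longrightarrow> int n dvd f' h - f h" "int n dvd f' x - y"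
proof -
  define H' where "H' = (\<lambda>(h, i::int). h \<otimes> x [^] i) ` (H \<times> UNIV)"
  define f' where "f' = (\<lambda>z. case SOME w. w \<in> H \<times> UNIV \<and> z = (\<lambda>(h, i::int). h \<otimes> x [^] i) w of (h, i) \<Rightarrow> f h + i * y)"
  have Hc: "h \<in> carrier G" if "h \<in> H" for h using that H by (rule subgroup.mem_carrier[rotated])
  have add: "int n dvd f (a \<otimes> b) - (f a + f b)" if "a \<in> H" "b \<in> H" for a b
    using f that by (simp add: additive_mod_on_def)
  \<comment> \<open>Two presentations of an element differ by x^(i-j), which lies in H. Hence i - j
    = m c, and the condition on y applies c times.\<close>
  have wd: "int n dvd (f h + i * y) - (f h' + j * y)"
    if h: "h \<in> H" "h' \<in> H" and eq: "h \<otimes> x [^] i = h' \<otimes> x [^] j" for h h' and i j :: int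
  proof -
    have "h' = h \<otimes> x [^] i \<otimes> x [^] (- j)"
      unfolding eq using h Hc x by (simp add: m_assoc int_pow_neg)
    then have h': "h' = h \<otimes> x [^] (i - j)"
      using h Hc x by (simp add: m_assoc int_pow_mult[symmetric])
    then have "x [^] (i - j) = inv h \<otimes> h'" using h Hc x by (simp add: m_assoc[symmetric])
    then have mem: "x [^] (i - j) \<in> H"
      using h H by (simp add: subgroup.m_closed subgroup.m_inv_closed)
    then obtain c where c: "i - j = int m * c" using m by blast
    have "x [^] (i - j) = (x [^] int m) [^] c" using x by (simp add: c int_pow_pow)
    then have 1: "int n dvd f (x [^] (i - j)) - c * f (x [^] int m)"
      using additive_mod_on_int_pow[OF f H, of "x [^] int m" c] m[of "int m"] by simp
    have 2: "int n dvd c * (int m * y - f (x [^] int m))" using y by simp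
    have 3: "int n dvd f h' - (f h + f (x [^] (i - j)))"
      using add[OF h(1) mem] h' by simp
    have "int n dvd c * (int m * y - f (x [^] int m)) -
        (f (x [^] (i - j)) - c * f (x [^] int m)) - (f h' - (f h + f (x [^] (i - j))))"
      by (rule dvd_diff[OF dvd_diff[OF 2 1] 3])
    also have "\<dots> = f h + (i - j) * y - f h'" unfolding c by (simp add: algebra_simps)
    finally show ?thesis by (simp add: algebra_simps)
  qed
  have f': "int n dvd f' (h \<otimes> x [^] i) - (f h + i * y)" if "h \<in> H" for h and i :: int
  proof -
    define w where "w = (SOME w. w \<in> H \<times> UNIV \<and> h \<otimes> x [^] i = (\<lambda>(h, i::int). h \<otimes> x [^] i) w)"
    have "(h, i) \<in> H \<times> UNIV \<and> h \<otimes> x [^] i = (\<lambda>(h, i::int). h \<otimes> x [^] i) (h, i)"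
      using that by simp
    then have w: "w \<in> H \<times> UNIV \<and> h \<otimes> x [^] i = (\<lambda>(h, i::int). h \<otimes> x [^] i) w"
      unfolding w_def by (rule someI)
    have "f' (h \<otimes> x [^] i) = (case w of (h, i) \<Rightarrow> f h + i * y)"
      unfolding f'_def w_def ..
    then show ?thesis using w wd[OF _ that, of "fst w" "snd w" i] by (cases w) auto
  qed
  have mult: "(h \<otimes> x [^] i) \<otimes> (h' \<otimes> x [^] j) = (h \<otimes> h') \<otimes> x [^] (i + j)"
    if "h \<in> H" "h' \<in> H" for h h' and i j :: int
    using that Hc x by (simp add: int_pow_mult[symmetric] m_ac)
  show thesis
  proof (rule that[of H' f'])
    show "subgroup H' G"
    proof (rule subgroupI)
      show "H' \<subseteq> carrier G" using Hc x by (auto simp: H'_def)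
      have "(\<one>, 0) \<in> H \<times> (UNIV :: int set)" using subgroup.one_closed[OF H] by simp
      then show "H' \<noteq> {}" unfolding H'_def by blast
    next
      fix a assume "a \<in> H'"
      then obtain h i where a: "a = h \<otimes> x [^] (i::int)" "h \<in> H" by (auto simp: H'_def)
      then have "inv a = (\<lambda>(h, i::int). h \<otimes> x [^] i) (inv h, - i)"
        using Hc x by (simp add: inv_mult int_pow_neg)
      then show "inv a \<in> H'" unfolding H'_def
        using a subgroup.m_inv_closed[OF H] by blast
    next
      fix a b assume "a \<in> H'" "b \<in> H'"
      then obtain h i h' j where ab: "a = h \<otimes> x [^] (i::int)" "h \<in> H"
        "b = h' \<otimes> x [^] (j::int)" "h' \<in> H" by (auto simp: H'_def)
      then have "a \<otimes> b = (\<lambda>(h, i::int). h \<otimes> x [^] i) (h \<otimes> h', i + j)" using mult by simp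
      then show "a \<otimes> b \<in> H'" unfolding H'_def
        using ab subgroup.m_closed[OF H] by blast
    qed
    show "H \<subseteq> H'"
    proof
      fix h assume h: "h \<in> H"
      then have "h = (\<lambda>(h, i::int). h \<otimes> x [^] i) (h, 0)" using Hc by simp
      then show "h \<in> H'" unfolding H'_def using h by blast
    qed
    have "x = (\<lambda>(h, i::int). h \<otimes> x [^] i) (\<one>, 1)" using x by (simp add: int_pow_1)
    then show "x \<in> H'" unfolding H'_def using subgroup.one_closed[OF H] by blast
    show "additive_mod_on G n H' f'"
      unfolding additive_mod_on_def
    proof (intro ballI)
      fix a b assume "a \<in> H'" "b \<in> H'"
      then obtain h i h' j where ab: "a = h \<otimes> x [^] (i::int)" "h \<in> H"
        "b = h' \<otimes> x [^] (j::int)" "h' \<in> H" by (auto simp: H'_def)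
      have "int n dvd (f' (h \<otimes> h' \<otimes> x [^] (i + j)) - (f (h \<otimes> h') + (i + j) * y))
          + (f (h \<otimes> h') - (f h + f h'))
          - (f' (h \<otimes> x [^] i) - (f h + i * y)) - (f' (h' \<otimes> x [^] j) - (f h' + j * y))"
        using ab subgroup.m_closed[OF H] by (intro dvd_diff dvd_add f' add) auto
      then show "int n dvd f' (a \<otimes> b) - (f' a + f' b)"
        using mult ab by (simp add: algebra_simps)
    qed
    show "int n dvd f' h - f h" if "h \<in> H" for h
      using f'[OF that, of 0] that Hc by simp
    have "int n dvd f \<one>"
      using add[of \<one> \<one>] subgroup.one_closed[OF H] by simp
    then have "int n dvd (f' (\<one> \<otimes> x [^] (1::int)) - (f \<one> + 1 * y)) + f \<one>"
      using f'[OF subgroup.one_closed[OF H], of 1] by (intro dvd_add)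
    then show "int n dvd f' x - y" using x by (simp add: int_pow_1)
  qed
qed

text \<open>The number m is the order of x modulo H, found as the least positive exponent; division
  with remainder gives the equivalence, and Lagrange's theorem the divisibility.\<close>

lemma int_pow_mem_subgroup:
  assumes fin: "finite (carrier G)" and H: "subgroup H G" and x: "x \<in> carrier G"
  obtains m where "m > 0" "m dvd order G" "\<And>i::int. x [^] i \<in> H \<longleftrightarrow> int m dvd i"
proof -
  define m where "m = (LEAST m. m > 0 \<and> x [^] int m \<in> H)"
  have n: "order G > 0" using fin order_gt_0_iff_finite by blast
  have xn: "x [^] int (order G) \<in> H"
    unfolding int_pow_int using x H by (simp add: pow_order_eq_1 subgroup.one_closed)
  have m: "m > 0 \<and> x [^] int m \<in> H"
    unfolding m_def by (rule LeastI[of _ "order G"]) (use n xn in blast)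
  have least: "m \<le> k" if "k > 0" "x [^] int k \<in> H" for k
    unfolding m_def by (rule Least_le) (use that in blast)
  have iff: "x [^] i \<in> H \<longleftrightarrow> int m dvd i" for i :: int
  proof
    assume "int m dvd i"
    then obtain c where "i = int m * c" by blast
    then have "x [^] i = (x [^] int m) [^] c" using x by (simp add: int_pow_pow)
    then show "x [^] i \<in> H" using m H by (simp add: subgroup_int_pow_closed)
  next
    assume i: "x [^] i \<in> H"
    define r where "r = nat (i mod int m)"
    have ri: "int r = i mod int m" using m by (simp add: r_def)
    have r: "int r = i + int m * (- (i div int m))"
      unfolding ri by (simp add: minus_mult_div_eq_mod)
    have "int r < int m" unfolding ri using m by simp
    then have "r < m" by simp
    have "x [^] int r = x [^] i \<otimes> (x [^] int m) [^] (- (i div int m))"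
      unfolding r by (simp only: int_pow_mult[OF x] int_pow_pow[OF x])
    then have "x [^] int r \<in> H"
      using i m H by (simp add: subgroup.m_closed subgroup_int_pow_closed)
    then have "r = 0" using least[of r] \<open>r < m\<close> by fastforce
    then show "int m dvd i" using ri by (simp add: dvd_eq_mod_eq_0)
  qed
  then have "m dvd order G" using xn by simp
  then show thesis using that m iff by blast
qed

text \<open>Adjoin one element x at a time. With n = m c, the multiple c f(x^m) is congruent to
  f(x^n) = f(1), hence to 0 modulo n, so m divides f(x^m) and a suitable value y for x
  exists.\<close>

lemma extend_additive_mod_to_carrier:
  assumes fin: "finite (carrier G)" and n: "n = order G"
  shows "\<lbrakk>subgroup H G; additive_mod_on G n H f\<rbrakk> \<Longrightarrow>
    \<exists>f'. additive_mod_on G n (carrier G) f' \<and> (\<forall>h\<in>H. int n dvd f' h - f h)"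
proof (induction "card (carrier G - H)" arbitrary: H f rule: less_induct)
  case less
  note H = less.prems(1) and f = less.prems(2)
  have Hc: "H \<subseteq> carrier G" using H by (rule subgroup.subset)
  show ?case
  proof (cases "H = carrier G")
    case True
    then show ?thesis using f by (intro exI[of _ f]) simp
  next
    case False
    then obtain x where x: "x \<in> carrier G" "x \<notin> H" using Hc by blast
    obtain m where m: "m > 0" "m dvd order G" "\<And>i::int. x [^] i \<in> H \<longleftrightarrow> int m dvd i"
      using int_pow_mem_subgroup[OF fin H x(1)] by blast
    obtain c where c: "n = m * c" using m(2) n by blast
    have n0: "n > 0" using fin order_gt_0_iff_finite n by blast
    have xm: "x [^] int m \<in> H" using m(3) by simp
    have "(x [^] int m) [^] int c = x [^] n"
      using x(1) c by (simp add: int_pow_int nat_pow_pow)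
    then have "(x [^] int m) [^] int c = \<one>" using x(1) n by (simp add: pow_order_eq_1)
    then have "int n dvd f \<one> - int c * f (x [^] int m)"
      using additive_mod_on_int_pow[OF f H xm, of "int c"] by simp
    moreover have "int n dvd f \<one>"
      using additive_mod_on_int_pow[OF f H subgroup.one_closed[OF H], of 0] by simp
    ultimately have "int n dvd int c * f (x [^] int m)" by (simp add: dvd_diff_right_iff)
    then have "int m dvd f (x [^] int m)" using c n0 by (simp add: mult.commute)
    then obtain y where "f (x [^] int m) = int m * y" by blast
    then have "int n dvd int m * y - f (x [^] int m)" by simp
    from extend_additive_mod[OF H f x(1) m(3) this] obtain H' f' where
      H': "subgroup H' G" "H \<subseteq> H'" "x \<in> H'" "additive_mod_on G n H' f'"
        "\<And>h. h \<in> H \<Longrightarrow> int n dvd f' h - f h" by metis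
    have "carrier G - H' \<subset> carrier G - H" using H' x by blast
    then have "card (carrier G - H') < card (carrier G - H)"
      using fin by (intro psubset_card_mono) auto
    from less.hyps[OF this H'(1,4)] obtain f'' where
      f'': "additive_mod_on G n (carrier G) f''" "\<forall>h\<in>H'. int n dvd f'' h - f' h" by blast
    have "int n dvd f'' h - f h" if "h \<in> H" for h
      using dvd_add[OF f''(2)[rule_format] H'(5)[OF that], of h] that H'(2) by auto
    then show ?thesis using f''(1) by blast
  qed
qed

text \<open>If v has order m > 1 and n = m c, then v may be sent to c, which is nonzero modulo n and
  killed by m. This character of the subgroup generated by v extends to the whole group.\<close>

lemma additive_mod_separates:
  assumes fin: "finite (carrier G)" and n: "n = order G" and v: "v \<in> carrier G" "v \<noteq> \<one>"
  obtains f where "additive_mod_on G n (carrier G) f" "\<not> int n dvd f v"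
proof -
  have triv: "subgroup {\<one>} G" by (rule triv_subgroup)
  have n0: "n > 0" using fin order_gt_0_iff_finite n by blast
  obtain m where m: "m > 0" "m dvd order G" "\<And>i::int. v [^] i \<in> {\<one>} \<longleftrightarrow> int m dvd i"
    using int_pow_mem_subgroup[OF fin triv v(1)] by blast
  have "m \<noteq> 1" using m(3)[of 1] v by (auto simp: int_pow_1)
  obtain c where c: "n = m * c" using m(2) n by blast
  have "additive_mod_on G n {\<one>} (\<lambda>_. 0)" by (simp add: additive_mod_on_def)
  moreover have "int n dvd int m * int c - 0" using c by simp
  ultimately obtain H f where H: "subgroup H G" "v \<in> H" "additive_mod_on G n H f"
    "int n dvd f v - int c"
    using extend_additive_mod[OF triv _ v(1) m(3), of n "\<lambda>_. 0" "int c"] by metis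
  from extend_additive_mod_to_carrier[OF fin n H(1,3)] H(2) obtain f' where
    f': "additive_mod_on G n (carrier G) f'" "int n dvd f' v - f v" by blast
  have "int n dvd f' v - int c" using dvd_add[OF f'(2) H(4)] by simp
  moreover have "\<not> int n dvd int c"
    using c n0 m(1) \<open>m \<noteq> 1\<close> by (auto dest: dvd_imp_le)
  ultimately have "\<not> int n dvd f' v" by (metis dvd_diff_right_iff)
  then show thesis using that f'(1) by blast
qed

end

text \<open>The evaluation pairing. All axioms are formal except nondegeneracy on the side of V,
  which says that characters separate points.\<close>

lemma residue_pairing_dual_group:
  assumes V: "comm_group V" and fin: "finite (carrier V)" and n: "n = order V"
  shows "residue_pairing (dual_group V) V n (dual_residue n)"
proof -
  interpret V: comm_group V by (rule V)
  have n0: "n > 0" using fin V.order_gt_0_iff_finite n by blast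
  note residue = rat_class_dual_residue[OF V fin n]
  show ?thesis
  proof (rule residue_pairing.intro)
    show "comm_group (dual_group V)" by (rule comm_group_dual_group[OF V])
    show "comm_group V" by (rule V)
    show "finite (carrier (dual_group V))" by (rule finite_dual_group[OF V fin])
    show "finite (carrier V)" "n > 0" by fact+
  next
    fix \<phi> \<psi> v assume *: "\<phi> \<in> carrier (dual_group V)" "\<psi> \<in> carrier (dual_group V)" "v \<in> carrier V"
    interpret D: comm_group "dual_group V" by (rule comm_group_dual_group[OF V])
    have "rat_class (of_int (dual_residue n (\<phi> \<otimes>\<^bsub>dual_group V\<^esub> \<psi>) v) / of_nat n) =
        (\<phi> \<otimes>\<^bsub>dual_group V\<^esub> \<psi>) v"
      using * by (intro residue[symmetric]) auto
    also have "\<dots> = \<phi> v \<otimes>\<^bsub>rat_mod_int\<^esub> \<psi> v" using * by (simp add: dual_group_simps)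
    also have "\<dots> = rat_class (of_int (dual_residue n \<phi> v + dual_residue n \<psi> v) / of_nat n)"
      by (subst (1 2) residue) (simp_all add: * rat_class_mult add_divide_distrib)
    finally show "int n dvd dual_residue n (\<phi> \<otimes>\<^bsub>dual_group V\<^esub> \<psi>) v - (dual_residue n \<phi> v + dual_residue n \<psi> v)"
      unfolding rat_class_fraction_eq_iff[OF n0] .
  next
    fix \<phi> v w assume *: "\<phi> \<in> carrier (dual_group V)" "v \<in> carrier V" "w \<in> carrier V"
    have "rat_class (of_int (dual_residue n \<phi> (v \<otimes>\<^bsub>V\<^esub> w)) / of_nat n) = \<phi> (v \<otimes>\<^bsub>V\<^esub> w)"
      using * by (intro residue[symmetric]) auto
    also have "\<dots> = \<phi> v \<otimes>\<^bsub>rat_mod_int\<^esub> \<phi> w" using * by (simp add: dual_group_simps hom_mult)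
    also have "\<dots> = rat_class (of_int (dual_residue n \<phi> v + dual_residue n \<phi> w) / of_nat n)"
      by (subst (1 2) residue) (simp_all add: * rat_class_mult add_divide_distrib)
    finally show "int n dvd dual_residue n \<phi> (v \<otimes>\<^bsub>V\<^esub> w) - (dual_residue n \<phi> v + dual_residue n \<phi> w)"
      unfolding rat_class_fraction_eq_iff[OF n0] .
  next
    fix \<phi> assume *: "\<phi> \<in> carrier (dual_group V)" "\<And>v. v \<in> carrier V \<Longrightarrow> int n dvd dual_residue n \<phi> v"
    have "\<phi> v = \<one>\<^bsub>rat_mod_int\<^esub>" if v: "v \<in> carrier V" for v
      using residue[OF *(1) v] *(2)[OF v] rat_class_fraction_eq_iff[OF n0, of _ 0]
      by (simp add: one_rat_mod_int)
    then show "\<phi> = \<one>\<^bsub>dual_group V\<^esub>"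
      using *(1) by (auto simp: dual_group_simps fun_eq_iff extensional_def)
  next
    fix v assume *: "v \<in> carrier V" "\<And>\<phi>. \<phi> \<in> carrier (dual_group V) \<Longrightarrow> int n dvd dual_residue n \<phi> v"
    show "v = \<one>\<^bsub>V\<^esub>"
    proof (rule ccontr)
      assume "v \<noteq> \<one>\<^bsub>V\<^esub>"
      then obtain f where f: "additive_mod_on V n (carrier V) f" "\<not> int n dvd f v"
        using V.additive_mod_separates[OF fin n *(1)] by blast
      define \<phi> where "\<phi> = (\<lambda>w\<in>carrier V. rat_class (of_int (f w) / of_nat n))"
      have "rat_class (of_int (f (w \<otimes>\<^bsub>V\<^esub> u)) / of_nat n) =
          rat_class (of_int (f w) / of_nat n + of_int (f u) / of_nat n)"
        if "w \<in> carrier V" "u \<in> carrier V" for w u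
      proof -
        have "rat_class (of_int (f (w \<otimes>\<^bsub>V\<^esub> u)) / of_nat n) = rat_class (of_int (f w + f u) / of_nat n)"
          unfolding rat_class_fraction_eq_iff[OF n0] using f(1) that by (simp add: additive_mod_on_def)
        then show ?thesis by (simp add: add_divide_distrib)
      qed
      then have \<phi>: "\<phi> \<in> carrier (dual_group V)"
        by (auto simp: dual_group_simps \<phi>_def hom_def carrier_rat_mod_int rat_class_mult)
      have "rat_class (of_int (f v) / of_nat n) = rat_class (of_int (dual_residue n \<phi> v) / of_nat n)"
        using residue[OF \<phi> *(1)] *(1) by (simp add: \<phi>_def)
      then have "int n dvd f v - dual_residue n \<phi> v" unfolding rat_class_fraction_eq_iff[OF n0] .
      then show False using *(2)[OF \<phi>] f(2) by (metis dvd_diff_left_iff)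
    qed
  qed
qed

section \<open>Invertibility of the order\<close>

text \<open>The canonical ring homomorphism from \<int>, through which integer matrices act over
  \<open>R\<close>.\<close>

definition int_elem :: "('k, 'r) ring_scheme \<Rightarrow> int \<Rightarrow> 'k"
  where "int_elem R z = add_pow R z \<one>\<^bsub>R\<^esub>"

context cring
begin

lemma int_elem_closed [simp]: "int_elem R z \<in> carrier R"
  by (simp add: int_elem_def add.int_pow_closed)

lemma int_elem_0 [simp]: "int_elem R 0 = \<zero>"
  by (simp add: int_elem_def add_pow_def)

lemma int_elem_1 [simp]: "int_elem R 1 = \<one>"
  by (simp add: int_elem_def)

lemma int_elem_add: "int_elem R (a + b) = int_elem R a \<oplus> int_elem R b"
  by (simp add: int_elem_def add.int_pow_mult)

lemma int_elem_diff: "int_elem R (a - b) = int_elem R a \<ominus> int_elem R b"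
  using int_elem_add[of "a - b" b] by (simp add: a_minus_def a_assoc r_neg)

lemma int_elem_mult: "int_elem R (a * b) = int_elem R a \<otimes> int_elem R b"
proof -
  have "int_elem R a \<otimes> int_elem R b = add_pow R a (\<one> \<otimes> int_elem R b)"
    unfolding int_elem_def by (rule add_pow_ldistr_int) (simp_all add: add.int_pow_closed)
  also have "\<dots> = int_elem R (b * a)"
    by (simp add: int_elem_def add.int_pow_closed add.int_pow_pow)
  finally show ?thesis by (simp add: mult.commute)
qed

lemma int_elem_sum: "finite A \<Longrightarrow> int_elem R (\<Sum>x\<in>A. f x) = (\<Oplus>x\<in>A. int_elem R (f x))"
  by (induction A rule: finite_induct) (simp_all add: int_elem_add finsum_insert Pi_iff)

lemma int_elem_Units_mult:
  "\<lbrakk>int_elem R a \<in> Units R; int_elem R b \<in> Units R\<rbrakk> \<Longrightarrow> int_elem R (a * b) \<in> Units R"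
  by (simp add: int_elem_mult Units_m_closed)

lemma int_elem_Units_power: "int_elem R a \<in> Units R \<Longrightarrow> int_elem R (a ^ r) \<in> Units R"
  by (induction r) (simp_all add: int_elem_Units_mult)

lemma int_elem_Units_prime_factors:
  "\<lbrakk>n > 0; \<And>p. \<lbrakk>prime p; p dvd n\<rbrakk> \<Longrightarrow> int_elem R (int p) \<in> Units R\<rbrakk>
    \<Longrightarrow> int_elem R (int n) \<in> Units R"
proof (induction n rule: less_induct)
  case (less n)
  show ?case
  proof (cases "n = 1")
    case False
    then obtain p m where p: "prime p" "n = p * m"
      using prime_factor_nat by (metis dvdE)
    then have m: "m < n" "m > 0" using less.prems(1) prime_gt_1_nat[OF p(1)] by auto
    have "int_elem R (int m) \<in> Units R" using less.IH[OF m] less.prems(2) p(2) by auto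
    then show ?thesis using less.prems(2)[OF p(1)] p(2) int_elem_Units_mult by simp
  qed simp
qed

lemma int_elem_dvd:
  assumes "a dvd b"
  shows "\<exists>c\<in>carrier R. int_elem R b = int_elem R a \<otimes> c"
  using assms int_elem_mult by (auto elim!: dvdE)

text \<open>This identity and the next rewrite the images of the two kinds of tensor relations;
  \<open>factor_left\<close> extracts p from the final Bezout relation.\<close>

lemma distrib_left_diff:
  "\<lbrakk>x \<in> carrier R; y \<in> carrier R; z \<in> carrier R\<rbrakk> \<Longrightarrow> x \<otimes> (y \<oplus> z) \<ominus> x \<otimes> y \<ominus> x \<otimes> z = \<zero>"
  by algebra

lemma distrib_right_diff:
  "\<lbrakk>s \<in> carrier R; t \<in> carrier R; u \<in> carrier R; x \<in> carrier R\<rbrakk> \<Longrightarrow>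
    s \<otimes> x \<ominus> t \<otimes> x \<ominus> u \<otimes> x = (s \<ominus> (t \<oplus> u)) \<otimes> x"
  by algebra

lemma factor_left:
  "\<lbrakk>x \<in> carrier R; y \<in> carrier R; z \<in> carrier R; c \<in> carrier R\<rbrakk> \<Longrightarrow>
    y \<otimes> x \<oplus> z \<otimes> (x \<otimes> c) = x \<otimes> (y \<oplus> z \<otimes> c)"
  by algebra

text \<open>
  The map \<open>(c, v) \<mapsto> b(v) c\<close> is bilinear modulo \<open>p\<close>, hence vanishes modulo \<open>p\<close>; so the unit
  \<open>b(v0)\<close> modulo \<open>p\<close> is divisible by \<open>p\<close>.
\<close>

lemma trivial_tensor_imp_prime_Units:
  assumes triv: "trivial_group (tensor (add_monoid R) V)"
    and p: "prime p"
    and b: "\<And>v w. \<lbrakk>v \<in> carrier V; w \<in> carrier V\<rbrakk> \<Longrightarrow> int p dvd b (v \<otimes>\<^bsub>V\<^esub> w) - (b v + b w)"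
    and V: "comm_group V" and v0: "v0 \<in> carrier V" "\<not> int p dvd b v0"
  shows "int_elem R (int p) \<in> Units R"
proof -
  interpret V: comm_group V by (rule V)
  let ?S = "carrier R \<times> carrier V"
  let ?F = "free_Abelian_group ?S"
  let ?T = "tensor_relations (add_monoid R) V"
  let ?P = "int_elem R (int p)"
  \<comment> \<open>This predicate describes the ideal generated by p. It replaces the passage to
    the quotient ring: h takes values in R, and relations are sent into this ideal rather than to
    0.\<close>
  define multiple where "multiple = (\<lambda>z. \<exists>c\<in>carrier R. z = ?P \<otimes> c)"
  have multiple_add: "multiple (y \<oplus> z)" if "multiple y" "multiple z" for y z
  proof -
    from that obtain c d where "c \<in> carrier R" "d \<in> carrier R" "y = ?P \<otimes> c" "z = ?P \<otimes> d"
      by (auto simp: multiple_def)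
    then have "y \<oplus> z = ?P \<otimes> (c \<oplus> d)" "c \<oplus> d \<in> carrier R" by (simp_all add: r_distr)
    then show ?thesis by (auto simp: multiple_def)
  qed
  have multiple_minus: "multiple (\<ominus> z)" if "multiple z" for z
  proof -
    from that obtain c where "c \<in> carrier R" "z = ?P \<otimes> c" by (auto simp: multiple_def)
    then have "\<ominus> z = ?P \<otimes> (\<ominus> c)" "\<ominus> c \<in> carrier R" by (simp_all add: r_minus)
    then show ?thesis by (auto simp: multiple_def)
  qed
  have multiple_0: "multiple \<zero>" unfolding multiple_def by (intro bexI[of _ \<zero>]) auto
  have f: "(\<lambda>(c, v). int_elem R (b v) \<otimes> c) ` ?S \<subseteq> carrier R" by auto
  obtain h where h: "h \<in> hom ?F (add_monoid R)"
    and h_of: "\<And>x. x \<in> ?S \<Longrightarrow> h (frag_of x) = (\<lambda>(c, v). int_elem R (b v) \<otimes> c) x"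
    by (rule add.free_Abelian_group_universal[OF f], rule that)
  interpret h: group_hom ?F "add_monoid R" h
    using h by (simp add: group_hom_def group_hom_axioms_def add.group_axioms)
  have frag: "frag_of x \<in> carrier ?F" if "x \<in> ?S" for x
    using that frag_of_in_free_Abelian_group[of x ?S] by blast
  have h_add: "h (x + y) = h x \<oplus> h y" if "x \<in> carrier ?F" "y \<in> carrier ?F" for x y
    using h.hom_mult[OF that] by simp
  have h_uminus: "h (- x) = \<ominus> h x" if "x \<in> carrier ?F" for x
  proof -
    have "inv\<^bsub>?F\<^esub> x = - x" using that by (intro inv_free_Abelian_group) simp
    then show ?thesis using h.hom_inv[OF that] by (simp only: a_inv_def)
  qed
  have uminus: "- x \<in> carrier ?F" if "x \<in> carrier ?F" for x
    using that by simp
  have h_diff: "h (x - y) = h x \<ominus> h y" if "x \<in> carrier ?F" "y \<in> carrier ?F" for x y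
    using h_add[OF that(1) uminus[OF that(2)]] unfolding h_uminus[OF that(2)] a_minus_def
    by (simp only: diff_conv_add_uminus)
  have diff: "x - y \<in> carrier ?F" if "x \<in> carrier ?F" "y \<in> carrier ?F" for x y
    using h.G.m_closed[OF that(1) uminus[OF that(2)]]
    by (simp only: mult_free_Abelian_group diff_conv_add_uminus)
  have rel: "x \<in> carrier ?F \<and> multiple (h x)" if "x \<in> ?T" for x
  proof -
    consider (left) a a' v where "x = frag_of (a \<oplus> a', v) - frag_of (a, v) - frag_of (a', v)"
        "a \<in> carrier R" "a' \<in> carrier R" "v \<in> carrier V"
      | (right) a v v' where "x = frag_of (a, v \<otimes>\<^bsub>V\<^esub> v') - frag_of (a, v) - frag_of (a, v')"
        "a \<in> carrier R" "v \<in> carrier V" "v' \<in> carrier V"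
      using \<open>x \<in> ?T\<close> unfolding tensor_relations_def by auto
    then show ?thesis
    proof cases
      case left
      let ?b = "int_elem R (b v)"
      have "h x = ?b \<otimes> (a \<oplus> a') \<ominus> ?b \<otimes> a \<ominus> ?b \<otimes> a'"
        unfolding left(1) using left(2-4)
        by (simp add: h_diff diff frag h_of del: carrier_free_Abelian_group_iff)
      also have "\<dots> = \<zero>" using left(2-4) by (intro distrib_left_diff) simp_all
      finally have "multiple (h x)" using multiple_0 by simp
      moreover have "x \<in> carrier ?F"
        unfolding left(1) using left(2-4) by (intro diff frag) simp_all
      ultimately show ?thesis by blast
    next
      case right
      have "h x = int_elem R (b (v \<otimes>\<^bsub>V\<^esub> v')) \<otimes> a \<ominus> int_elem R (b v) \<otimes> a \<ominus> int_elem R (b v') \<otimes> a"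
        unfolding right(1) using right(2-4)
        by (simp add: h_diff diff frag h_of del: carrier_free_Abelian_group_iff)
      also have "\<dots> = (int_elem R (b (v \<otimes>\<^bsub>V\<^esub> v')) \<ominus> (int_elem R (b v) \<oplus> int_elem R (b v'))) \<otimes> a"
        using right(2-4) by (intro distrib_right_diff) simp_all
      also have "\<dots> = int_elem R (b (v \<otimes>\<^bsub>V\<^esub> v') - (b v + b v')) \<otimes> a"
        by (simp add: int_elem_diff int_elem_add)
      finally have hx: "h x = int_elem R (b (v \<otimes>\<^bsub>V\<^esub> v') - (b v + b v')) \<otimes> a" .
      obtain c where "c \<in> carrier R" "int_elem R (b (v \<otimes>\<^bsub>V\<^esub> v') - (b v + b v')) = ?P \<otimes> c"
        using int_elem_dvd[OF b[OF right(3,4)]] by blast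
      then have "multiple (h x)"
        unfolding multiple_def hx using right(2) by (intro bexI[of _ "c \<otimes> a"]) (simp_all add: m_assoc)
      moreover have "x \<in> carrier ?F"
        unfolding right(1) using right(2-4) by (intro diff frag) simp_all
      ultimately show ?thesis by blast
    qed
  qed
  have gen: "x \<in> carrier ?F \<and> multiple (h x)" if "x \<in> generate ?F ?T" for x
    using that
  proof induction
    case one
    then show ?case using multiple_0 h.hom_one by simp
  next
    case (incl x)
    then show ?case by (rule rel)
  next
    case (inv x)
    then have "x \<in> carrier ?F" "multiple (h x)" using rel by auto
    then show ?case using h_uminus uminus multiple_minus by simp
  next
    case (eng x y)
    then show ?case using h_add multiple_add h.G.m_closed[of x y] by simp
  qed
  have "\<one> \<in> carrier R" by simp
  then have x: "frag_of (\<one>, v0) \<in> carrier ?F" using v0(1) by (intro frag) simp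
  let ?N = "generate ?F ?T"
  \<comment> \<open>The quotient has one element, so the coset of the symbol (1, v0) is the relation
    subgroup itself and its image b(v0) is a multiple of p.\<close>
  have "carrier (?F Mod ?N) = {?N}"
    using triv by (simp add: trivial_group_def tensor_def Let_def)
  then have "?N #>\<^bsub>?F\<^esub> frag_of (\<one>, v0) = ?N"
    using x unfolding carrier_FactGroup by blast
  moreover have "frag_of (\<one>, v0) \<in> ?N #>\<^bsub>?F\<^esub> frag_of (\<one>, v0)"
    unfolding r_coset_def using generate.one[of ?F ?T] by force
  ultimately have "multiple (h (frag_of (\<one>, v0)))" using gen by blast
  then have "multiple (int_elem R (b v0))" using h_of[of "(\<one>, v0)"] v0(1) by simp
  then obtain c where c: "c \<in> carrier R" "int_elem R (b v0) = ?P \<otimes> c"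
    unfolding multiple_def by blast
  \<comment> \<open>From u p + w b(v0) = 1 and b(v0) = p c in R follows p (u + w c) = 1.\<close>
  have "coprime (int p) (b v0)"
    using p v0(2) by (intro prime_imp_coprime) simp_all
  then obtain u w where uw: "u * int p + w * b v0 = 1"
    using bezout_int[of "int p" "b v0"] by (auto simp: coprime_iff_gcd_eq_1)
  have "\<one> = int_elem R u \<otimes> ?P \<oplus> int_elem R w \<otimes> (?P \<otimes> c)"
    using arg_cong[OF uw, of "int_elem R"] c by (simp add: int_elem_add int_elem_mult)
  also have "\<dots> = ?P \<otimes> (int_elem R u \<oplus> int_elem R w \<otimes> c)"
    using c(1) by (intro factor_left) simp_all
  finally have "?P \<otimes> (int_elem R u \<oplus> int_elem R w \<otimes> c) \<in> Units R" by (metis Units_one_closed)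
  then show ?thesis by (rule unit_factor) (use c(1) in simp_all)
qed

end

text \<open>Supplies the map b of the preceding argument. The dual has the same order, so it
  contains a character of order p. Its numerators over n are divisible by n/p, and dividing them by
  n/p gives a nonzero homomorphism to the integers modulo p.\<close>

lemma (in comm_group) exists_additive_mod_prime:
  assumes fin: "finite (carrier G)" and p: "prime p" "p dvd order G"
  obtains b v0 where "\<And>v w. \<lbrakk>v \<in> carrier G; w \<in> carrier G\<rbrakk> \<Longrightarrow> int p dvd b (v \<otimes> w) - (b v + b w)"
    "v0 \<in> carrier G" "\<not> int p dvd b v0"
proof -
  define n where "n = order G"
  let ?W = "dual_group G"
  let ?\<beta> = "dual_residue n"
  have n0: "n > 0" using fin order_gt_0_iff_finite n_def by blast
  interpret residue_pairing ?W G n ?\<beta>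
    by (rule residue_pairing_dual_group[OF comm_group_axioms fin n_def])
  interpret W: comm_group ?W by (rule comm_group_left)
  obtain n' where n': "n = p * n'" using p(2) unfolding n_def by (rule dvdE)
  \<comment> \<open>Sylow's theorem with exponent 1 serves as Cauchy's theorem.\<close>
  obtain K where K: "subgroup K ?W" "card K = p ^ 1"
    using sylow_thm[OF p(1) W.group_axioms, of 1 n'] order_eq n' n_def finite_left by auto
  have "\<not> K \<subseteq> {\<one>\<^bsub>?W\<^esub>}"
  proof
    assume "K \<subseteq> {\<one>\<^bsub>?W\<^esub>}"
    then have "card K \<le> card {\<one>\<^bsub>?W\<^esub>}" by (intro card_mono) simp_all
    then show False using K(2) prime_gt_1_nat[OF p(1)] by simp
  qed
  then obtain \<phi> where \<phi>: "\<phi> \<in> K" "\<phi> \<noteq> \<one>\<^bsub>?W\<^esub>" by blast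
  have \<phi>W: "\<phi> \<in> carrier ?W" using \<phi>(1) K(1) by (rule subgroup.mem_carrier[rotated])
  interpret K: group "?W\<lparr>carrier := K\<rparr>" by (rule W.subgroup_imp_group[OF K(1)])
  have "\<phi> [^]\<^bsub>?W\<lparr>carrier := K\<rparr>\<^esub> order (?W\<lparr>carrier := K\<rparr>) = \<one>\<^bsub>?W\<^esub>"
    using K.pow_order_eq_1[of \<phi>] \<phi>(1) by simp
  then have pow: "\<phi> [^]\<^bsub>?W\<^esub> p = \<one>\<^bsub>?W\<^esub>"
    using K(2) W.nat_pow_consistent[of \<phi> p K] by (simp add: order_def)
  have dvd: "int n' dvd ?\<beta> \<phi> v" if v: "v \<in> carrier G" for v
  proof -
    have "int n dvd ?\<beta> (\<phi> [^]\<^bsub>?W\<^esub> p) v - int p * ?\<beta> \<phi> v"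
      by (rule W.additive_mod_pow[of n "\<lambda>\<phi>. ?\<beta> \<phi> v"]) (use mult_left v \<phi>W in auto)
    then have "int n dvd int p * ?\<beta> \<phi> v"
      using one_left[OF v] unfolding pow by (simp add: dvd_diff_right_iff)
    then show ?thesis using prime_gt_0_nat[OF p(1)] by (simp add: n')
  qed
  define b where "b = (\<lambda>v. ?\<beta> \<phi> v div int n')"
  have b: "?\<beta> \<phi> v = int n' * b v" if "v \<in> carrier G" for v
    using dvd[OF that] by (simp add: b_def)
  have n'0: "n' > 0" using n0 n' by (cases "n' = 0") auto
  have n_eq: "int n = int n' * int p" using n' by simp
  have add: "int p dvd b (v \<otimes> w) - (b v + b w)" if "v \<in> carrier G" "w \<in> carrier G" for v w
  proof -
    have "int n dvd int n' * b (v \<otimes> w) - (int n' * b v + int n' * b w)"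
      using mult_right[OF \<phi>W that] that by (simp add: b)
    then have "int n' * int p dvd int n' * (b (v \<otimes> w) - (b v + b w))"
      unfolding n_eq by (simp add: algebra_simps)
    then show ?thesis using n'0 by simp
  qed
  obtain v0 where v0: "v0 \<in> carrier G" "\<not> int n dvd ?\<beta> \<phi> v0"
    using nondegenerate_left[OF \<phi>W] \<phi>(2) by blast
  then have "\<not> int n dvd int n' * b v0" by (simp add: b)
  then have "\<not> int p dvd b v0" using n'0 unfolding n_eq by simp
  then show thesis using that add v0(1) by blast
qed

lemma (in cring) trivial_tensor_imp_order_Units:
  assumes V: "comm_group V" "finite (carrier V)" and triv: "trivial_group (tensor (add_monoid R) V)"
  shows "int_elem R (int (order V)) \<in> Units R"
proof (rule int_elem_Units_prime_factors)
  interpret V: comm_group V by (rule V(1))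
  show "order V > 0" using V(2) V.order_gt_0_iff_finite by blast
  fix p assume p: "prime p" "p dvd order V"
  obtain b v0 where
    "\<And>v w. \<lbrakk>v \<in> carrier V; w \<in> carrier V\<rbrakk> \<Longrightarrow> int p dvd b (v \<otimes>\<^bsub>V\<^esub> w) - (b v + b w)"
    "v0 \<in> carrier V" "\<not> int p dvd b v0"
    using V.exists_additive_mod_prime[OF V(2) p] by blast
  then show "int_elem R (int p) \<in> Units R"
    by (intro trivial_tensor_imp_prime_Units[OF triv p(1) _ V(1)])
qed

section \<open>Integer matrices over a ring\<close>

context cring
begin

lemma finsum_swap:
  assumes "finite A" "finite B" "\<And>a b. \<lbrakk>a \<in> A; b \<in> B\<rbrakk> \<Longrightarrow> f a b \<in> carrier R"
  shows "(\<Oplus>a\<in>A. \<Oplus>b\<in>B. f a b) = (\<Oplus>b\<in>B. \<Oplus>a\<in>A. f a b)"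
  using assms(1,3)
proof (induction A rule: finite_induct)
  case (insert x A)
  have "(\<Oplus>a\<in>insert x A. \<Oplus>b\<in>B. f a b) = (\<Oplus>b\<in>B. f x b) \<oplus> (\<Oplus>b\<in>B. \<Oplus>a\<in>A. f a b)"
    using insert by (simp add: finsum_insert finsum_closed Pi_iff)
  also have "\<dots> = (\<Oplus>b\<in>B. f x b \<oplus> (\<Oplus>a\<in>A. f a b))"
    using insert by (intro finsum_addf[symmetric]) (auto intro!: finsum_closed)
  also have "\<dots> = (\<Oplus>b\<in>B. \<Oplus>a\<in>insert x A. f a b)"
    using insert by (intro finsum_cong') (auto simp: finsum_insert intro!: finsum_closed a_closed)
  finally show ?case .
qed (simp add: finsum_zero)

lemma finsum_delta:
  assumes "finite A" "i \<in> A" "f \<in> A \<rightarrow> carrier R"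
  shows "(\<Oplus>j\<in>A. if j = i then f j else \<zero>) = f i"
    and "(\<Oplus>j\<in>A. if i = j then f j else \<zero>) = f i"
  using finsum_singleton[OF assms(2,1,3)] add.finprod_singleton_swap[OF assms(2,1,3)]
  by (simp_all add: eq_commute)

lemma finsum_mult_of_bool:
  assumes "finite A" "t \<in> A" "u \<in> A \<rightarrow> carrier R"
  shows "(\<Oplus>x\<in>A. u x \<otimes> int_elem R (m * of_bool (x = t))) = u t \<otimes> int_elem R m"
proof -
  have eq: "(\<Oplus>x\<in>A. u x \<otimes> int_elem R (m * of_bool (x = t))) =
      (\<Oplus>x\<in>A. if x = t then u x \<otimes> int_elem R m else \<zero>)"
    using assms(2,3) by (intro finsum_cong') (auto simp: Pi_iff)
  also have "\<dots> = u t \<otimes> int_elem R m"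
    using assms by (intro finsum_delta(1)) auto
  finally show ?thesis .
qed

definition matrix_map :: "'c set \<Rightarrow> 'd set \<Rightarrow> ('d \<Rightarrow> 'c \<Rightarrow> int) \<Rightarrow> ('c \<Rightarrow> 'a) \<Rightarrow> 'd \<Rightarrow> 'a"
  where "matrix_map V W K u = (\<lambda>x\<in>W. \<Oplus>v\<in>V. u v \<otimes> int_elem R (K x v))"

lemma matrix_map_closed:
  assumes "u \<in> V \<rightarrow>\<^sub>E carrier R"
  shows "matrix_map V W K u \<in> W \<rightarrow>\<^sub>E carrier R"
  using assms unfolding matrix_map_def by (auto intro!: finsum_closed)

text \<open>A combination of rows equal to m \<delta>_t recovers m u(t) from the image of u, and m
  is a unit.\<close>

lemma matrix_map_inj:
  assumes fin: "finite V" "finite W"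
    and K: "\<And>t. t \<in> V \<Longrightarrow> \<exists>m a. int_elem R m \<in> Units R \<and>
      (\<forall>v\<in>V. m * of_bool (v = t) = (\<Sum>x\<in>W. a x * K x v))"
  shows "inj_on (matrix_map V W K) (V \<rightarrow>\<^sub>E carrier R)"
proof (rule inj_onI)
  have recover: "\<exists>m a. int_elem R m \<in> Units R \<and> (\<forall>u \<in> V \<rightarrow>\<^sub>E carrier R.
    u t \<otimes> int_elem R m = (\<Oplus>x\<in>W. int_elem R (a x) \<otimes> matrix_map V W K u x))" if t: "t \<in> V" for t
  proof -
    obtain m a where m: "int_elem R m \<in> Units R"
      and a: "\<forall>v\<in>V. m * of_bool (v = t) = (\<Sum>x\<in>W. a x * K x v)"
      using K[OF t] by blast
    have "u t \<otimes> int_elem R m = (\<Oplus>x\<in>W. int_elem R (a x) \<otimes> matrix_map V W K u x)"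
      if u: "u \<in> V \<rightarrow>\<^sub>E carrier R" for u
    proof -
      have uc: "u v \<in> carrier R" if "v \<in> V" for v using u that by auto
      have "u t \<otimes> int_elem R m = (\<Oplus>v\<in>V. u v \<otimes> int_elem R (m * of_bool (v = t)))"
        using fin(1) t uc by (intro finsum_mult_of_bool[symmetric]) auto
      also have "\<dots> = (\<Oplus>v\<in>V. \<Oplus>x\<in>W. u v \<otimes> (int_elem R (a x) \<otimes> int_elem R (K x v)))"
      proof (intro finsum_cong' refl)
        fix v assume v: "v \<in> V"
        have "int_elem R (m * of_bool (v = t)) = (\<Oplus>x\<in>W. int_elem R (a x) \<otimes> int_elem R (K x v))"
          using a v fin(2) by (simp add: int_elem_sum int_elem_mult)
        then show "u v \<otimes> int_elem R (m * of_bool (v = t)) =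
            (\<Oplus>x\<in>W. u v \<otimes> (int_elem R (a x) \<otimes> int_elem R (K x v)))"
          using fin(2) uc[OF v] by (simp add: finsum_rdistr)
      qed (use uc in \<open>auto intro!: finsum_closed\<close>)
      also have "\<dots> = (\<Oplus>x\<in>W. \<Oplus>v\<in>V. u v \<otimes> (int_elem R (a x) \<otimes> int_elem R (K x v)))"
        using fin uc by (intro finsum_swap) auto
      also have "\<dots> = (\<Oplus>x\<in>W. int_elem R (a x) \<otimes> matrix_map V W K u x)"
      proof (intro finsum_cong' refl)
        fix x assume x: "x \<in> W"
        have "(\<Oplus>v\<in>V. u v \<otimes> (int_elem R (a x) \<otimes> int_elem R (K x v))) =
            (\<Oplus>v\<in>V. int_elem R (a x) \<otimes> (u v \<otimes> int_elem R (K x v)))"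
          using uc by (intro finsum_cong') (auto simp: m_lcomm)
        also have "\<dots> = int_elem R (a x) \<otimes> (\<Oplus>v\<in>V. u v \<otimes> int_elem R (K x v))"
          using fin(1) uc by (intro finsum_rdistr[symmetric]) auto
        finally show "(\<Oplus>v\<in>V. u v \<otimes> (int_elem R (a x) \<otimes> int_elem R (K x v))) =
            int_elem R (a x) \<otimes> matrix_map V W K u x"
          using x by (simp add: matrix_map_def)
      qed (use matrix_map_closed[OF u, of W K] in auto)
      finally show ?thesis .
    qed
    then show ?thesis using m by blast
  qed
  fix u u' assume u: "u \<in> V \<rightarrow>\<^sub>E carrier R" "u' \<in> V \<rightarrow>\<^sub>E carrier R"
    and eq: "matrix_map V W K u = matrix_map V W K u'"
  have "u t = u' t" if t: "t \<in> V" for t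
  proof -
    obtain m a where m: "int_elem R m \<in> Units R" and a: "\<forall>u \<in> V \<rightarrow>\<^sub>E carrier R.
        u t \<otimes> int_elem R m = (\<Oplus>x\<in>W. int_elem R (a x) \<otimes> matrix_map V W K u x)"
      using recover[OF t] by blast
    have "u t \<otimes> int_elem R m = u' t \<otimes> int_elem R m" using a u eq by simp
    moreover have "u t \<in> carrier R" "u' t \<in> carrier R" using u t by auto
    ultimately show ?thesis using m by (metis Units_l_cancel m_comm int_elem_closed)
  qed
  then show "u = u'" using u by (intro PiE_ext) auto
qed

text \<open>A combination of columns equal to m \<delta>_t puts \<delta>_t into the image after
  division by the unit m; a preimage of w is assembled from these with the coefficients
  w(t)/m.\<close>

lemma matrix_map_surj:
  assumes fin: "finite V" "finite W"
    and K: "\<And>t. t \<in> W \<Longrightarrow> \<exists>m a. int_elem R m \<in> Units R \<and>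
      (\<forall>x\<in>W. m * of_bool (x = t) = (\<Sum>v\<in>V. a v * K x v))"
    and w: "w \<in> W \<rightarrow>\<^sub>E carrier R"
  shows "w \<in> matrix_map V W K ` (V \<rightarrow>\<^sub>E carrier R)"
proof -
  from K obtain m a where m: "\<And>t. t \<in> W \<Longrightarrow> int_elem R (m t) \<in> Units R"
    and a: "\<And>t x. \<lbrakk>t \<in> W; x \<in> W\<rbrakk> \<Longrightarrow> m t * of_bool (x = t) = (\<Sum>v\<in>V. a t v * K x v)"
    by metis
  define c where "c = (\<lambda>t. w t \<otimes> inv (int_elem R (m t)))"
  have c: "c t \<in> carrier R" "c t \<otimes> int_elem R (m t) = w t" if "t \<in> W" for t
  proof -
    have "w t \<in> carrier R" using w that by auto
    then show "c t \<in> carrier R" "c t \<otimes> int_elem R (m t) = w t"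
      using m[OF that] by (simp_all add: c_def m_assoc)
  qed
  define u where "u = (\<lambda>v\<in>V. \<Oplus>t\<in>W. c t \<otimes> int_elem R (a t v))"
  have u: "u \<in> V \<rightarrow>\<^sub>E carrier R" using c(1) by (auto simp: u_def intro!: finsum_closed)
  have "matrix_map V W K u x = w x" if x: "x \<in> W" for x
  proof -
    have "matrix_map V W K u x =
        (\<Oplus>v\<in>V. \<Oplus>t\<in>W. c t \<otimes> (int_elem R (a t v) \<otimes> int_elem R (K x v)))"
      unfolding matrix_map_def restrict_apply'[OF x]
    proof (intro finsum_cong' refl)
      fix v assume v: "v \<in> V"
      have "u v \<otimes> int_elem R (K x v) = (\<Oplus>t\<in>W. c t \<otimes> int_elem R (a t v) \<otimes> int_elem R (K x v))"
        using v fin(2) c(1) unfolding u_def by (simp add: finsum_ldistr Pi_iff)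
      also have "\<dots> = (\<Oplus>t\<in>W. c t \<otimes> (int_elem R (a t v) \<otimes> int_elem R (K x v)))"
        using c(1) by (intro finsum_cong') (auto simp: m_assoc)
      finally show "u v \<otimes> int_elem R (K x v) =
          (\<Oplus>t\<in>W. c t \<otimes> (int_elem R (a t v) \<otimes> int_elem R (K x v)))" .
    qed (use c(1) in \<open>auto intro!: finsum_closed\<close>)
    also have "\<dots> = (\<Oplus>t\<in>W. \<Oplus>v\<in>V. c t \<otimes> (int_elem R (a t v) \<otimes> int_elem R (K x v)))"
      using fin c(1) by (intro finsum_swap) auto
    also have "\<dots> = (\<Oplus>t\<in>W. if x = t then w t else \<zero>)"
    proof (intro finsum_cong' refl)
      fix t assume t: "t \<in> W"
      have "(\<Oplus>v\<in>V. c t \<otimes> (int_elem R (a t v) \<otimes> int_elem R (K x v))) =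
          c t \<otimes> (\<Oplus>v\<in>V. int_elem R (a t v) \<otimes> int_elem R (K x v))"
        using fin(1) c(1)[OF t] by (intro finsum_rdistr[symmetric]) auto
      also have "(\<Oplus>v\<in>V. int_elem R (a t v) \<otimes> int_elem R (K x v)) = int_elem R (m t * of_bool (x = t))"
        using a[OF t x] fin(1) by (simp add: int_elem_sum int_elem_mult)
      also have "c t \<otimes> int_elem R (m t * of_bool (x = t)) = (if x = t then w t else \<zero>)"
        using c[OF t] by simp
      finally show "(\<Oplus>v\<in>V. c t \<otimes> (int_elem R (a t v) \<otimes> int_elem R (K x v))) =
          (if x = t then w t else \<zero>)" .
    qed (use w in auto)
    also have "\<dots> = w x" using fin(2) x w by (intro finsum_delta(2)) auto
    finally show ?thesis .
  qed
  then have "matrix_map V W K u = w"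
    using matrix_map_closed[OF u, of W K] w by (intro PiE_ext[of _ W "\<lambda>_. carrier R"]) auto
  then show ?thesis using u by blast
qed

section \<open>Linear extensions of maps and linearity of matrix maps\<close>

lemma free_map_apply:
  assumes "finite E" "u \<in> E \<rightarrow> carrier R" "d \<in> E'"
  shows "free_map R E E' s u d = (\<Oplus>e\<in>E. if s e = d then u e else \<zero>)"
proof -
  have "(\<Oplus>e\<in>{e \<in> E. s e = d \<and> u e \<noteq> \<zero>}. u e) = (\<Oplus>e\<in>E. if s e = d then u e else \<zero>)"
    using assms(1,2) by (intro add.finprod_mono_neutral_cong_left) auto
  then show ?thesis using assms(3) by (simp add: free_map_def)
qed

lemma free_map_closed:
  assumes "finite E" "u \<in> E \<rightarrow> carrier R"
  shows "free_map R E E' s u \<in> E' \<rightarrow>\<^sub>E carrier R"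
  using assms(2) unfolding free_map_def by (auto intro!: finsum_closed)

text \<open>Change of variables along s; both the compatibility of k[A] with composition and the
  naturality of the duality map reduce to it.\<close>

lemma finsum_free_map:
  assumes fin: "finite E" "finite E'" and s: "s \<in> E \<rightarrow> E'" and u: "u \<in> E \<rightarrow> carrier R"
    and c: "c \<in> E' \<rightarrow> carrier R"
  shows "(\<Oplus>d\<in>E'. free_map R E E' s u d \<otimes> c d) = (\<Oplus>e\<in>E. u e \<otimes> c (s e))"
proof -
  have uc: "u e \<in> carrier R" if "e \<in> E" for e using u that by auto
  have cc: "c d \<in> carrier R" if "d \<in> E'" for d using c that by auto
  have sE: "s e \<in> E'" if "e \<in> E" for e using s that by auto
  have "(\<Oplus>d\<in>E'. free_map R E E' s u d \<otimes> c d) =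
      (\<Oplus>d\<in>E'. \<Oplus>e\<in>E. if s e = d then u e \<otimes> c d else \<zero>)"
  proof (intro finsum_cong' refl)
    fix d assume d: "d \<in> E'"
    have "free_map R E E' s u d \<otimes> c d = (\<Oplus>e\<in>E. (if s e = d then u e else \<zero>) \<otimes> c d)"
      unfolding free_map_apply[OF fin(1) u d]
      using fin(1) cc[OF d] uc by (intro finsum_ldistr) auto
    also have "\<dots> = (\<Oplus>e\<in>E. if s e = d then u e \<otimes> c d else \<zero>)"
      using cc[OF d] uc by (intro finsum_cong') auto
    finally show "free_map R E E' s u d \<otimes> c d = (\<Oplus>e\<in>E. if s e = d then u e \<otimes> c d else \<zero>)" .
  qed (use cc uc in \<open>auto intro!: finsum_closed\<close>)
  also have "\<dots> = (\<Oplus>e\<in>E. \<Oplus>d\<in>E'. if s e = d then u e \<otimes> c d else \<zero>)"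
    using fin cc uc by (intro finsum_swap) auto
  also have "\<dots> = (\<Oplus>e\<in>E. u e \<otimes> c (s e))"
  proof (intro finsum_cong' refl)
    fix e assume e: "e \<in> E"
    show "(\<Oplus>d\<in>E'. if s e = d then u e \<otimes> c d else \<zero>) = u e \<otimes> c (s e)"
      using e fin(2) sE cc uc by (intro finsum_delta(2)) auto
  qed (use cc uc sE in auto)
  finally show ?thesis .
qed

lemma fun_module_simps:
  "carrier (fun_module R E) = E \<rightarrow>\<^sub>E carrier R"
  "u \<oplus>\<^bsub>fun_module R E\<^esub> v = (\<lambda>e\<in>E. u e \<oplus> v e)"
  "c \<odot>\<^bsub>fun_module R E\<^esub> u = (\<lambda>e\<in>E. c \<otimes> u e)"
  "\<zero>\<^bsub>fun_module R E\<^esub> = (\<lambda>e\<in>E. \<zero>)"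
  by (simp_all add: fun_module_def)

lemma free_module_eq_fun_module:
  assumes "finite E"
  shows "free_module R E = fun_module R E"
  using assms by (simp add: free_module_def fun_module_def)

lemma module_fun_module: "module R (fun_module R E)"
proof (rule moduleI)
  show "cring R" by (rule is_cring)
  show "abelian_group (fun_module R E)"
  proof (rule abelian_groupI, goal_cases)
    case (6 u)
    then have "(\<lambda>e\<in>E. \<ominus> u e) \<in> carrier (fun_module R E)"
      "(\<lambda>e\<in>E. \<ominus> u e) \<oplus>\<^bsub>fun_module R E\<^esub> u = \<zero>\<^bsub>fun_module R E\<^esub>"
      by (auto simp: fun_module_simps fun_eq_iff PiE_iff l_neg)
    then show ?case by blast
  next
    case (5 u)
    then show ?case
      by (intro PiE_ext[of _ E "\<lambda>_. carrier R"]) (auto simp: fun_module_simps PiE_iff)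
  qed (auto simp: fun_module_simps fun_eq_iff PiE_iff a_ac)
next
  fix u assume "u \<in> carrier (fun_module R E)"
  then show "\<one> \<odot>\<^bsub>fun_module R E\<^esub> u = u"
    by (intro PiE_ext[of _ E "\<lambda>_. carrier R"]) (auto simp: fun_module_simps PiE_iff)
qed (auto simp: fun_module_simps fun_eq_iff PiE_iff l_distr r_distr m_assoc)

lemma matrix_map_mod_hom:
  assumes "finite V"
  shows "matrix_map V W K \<in> mod_hom R (fun_module R V) (fun_module R W)"
proof -
  have "matrix_map V W K (\<lambda>v\<in>V. u v \<oplus> u' v) x = matrix_map V W K u x \<oplus> matrix_map V W K u' x"
    if "u \<in> V \<rightarrow>\<^sub>E carrier R" "u' \<in> V \<rightarrow>\<^sub>E carrier R" "x \<in> W" for u u' x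
  proof -
    have "(\<Oplus>v\<in>V. (\<lambda>v\<in>V. u v \<oplus> u' v) v \<otimes> int_elem R (K x v)) =
        (\<Oplus>v\<in>V. u v \<otimes> int_elem R (K x v) \<oplus> u' v \<otimes> int_elem R (K x v))"
      using that by (intro finsum_cong') (auto simp: l_distr PiE_iff)
    also have "\<dots> = (\<Oplus>v\<in>V. u v \<otimes> int_elem R (K x v)) \<oplus> (\<Oplus>v\<in>V. u' v \<otimes> int_elem R (K x v))"
      using that by (intro finsum_addf) auto
    finally show ?thesis using that(3) by (simp add: matrix_map_def)
  qed
  moreover have "matrix_map V W K (\<lambda>v\<in>V. c \<otimes> u v) x = c \<otimes> matrix_map V W K u x"
    if "c \<in> carrier R" "u \<in> V \<rightarrow>\<^sub>E carrier R" "x \<in> W" for c u x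
  proof -
    have "(\<Oplus>v\<in>V. (\<lambda>v\<in>V. c \<otimes> u v) v \<otimes> int_elem R (K x v)) =
        (\<Oplus>v\<in>V. c \<otimes> (u v \<otimes> int_elem R (K x v)))"
      using that by (intro finsum_cong') (auto simp: m_assoc PiE_iff)
    also have "\<dots> = c \<otimes> (\<Oplus>v\<in>V. u v \<otimes> int_elem R (K x v))"
      using that assms by (intro finsum_rdistr[symmetric]) auto
    finally show ?thesis using that(3) by (simp add: matrix_map_def)
  qed
  ultimately show ?thesis
    unfolding mod_hom_def fun_module_simps
  proof (intro CollectI conjI ballI, goal_cases)
    case 1
    show ?case by (intro Pi_I matrix_map_closed)
  next
    case (2 u u')
    show ?case
    proof (rule ext)
      show "matrix_map V W K (\<lambda>v\<in>V. u v \<oplus> u' v) x =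
          (\<lambda>x\<in>W. matrix_map V W K u x \<oplus> matrix_map V W K u' x) x" for x
        using 2(1)[OF 2(3,4)] by (cases "x \<in> W") (simp_all, simp add: matrix_map_def)
    qed
  next
    case (3 c u)
    show ?case
    proof (rule ext)
      show "matrix_map V W K (\<lambda>v\<in>V. c \<otimes> u v) x = (\<lambda>x\<in>W. c \<otimes> matrix_map V W K u x) x" for x
        using 3(2)[OF 3(3,4)] by (cases "x \<in> W") (simp_all, simp add: matrix_map_def)
    qed
  qed
qed

text \<open>Elements of \<open>mod_hom\<close> are unrestricted off the carrier, so agreement there
  suffices; the module axioms keep sums and multiples inside the carrier.\<close>

lemma mod_hom_cong:
  assumes "module R M" "h \<in> mod_hom R M N" "\<And>u. u \<in> carrier M \<Longrightarrow> h' u = h u"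
  shows "h' \<in> mod_hom R M N"
proof -
  interpret M: module R M by (rule assms(1))
  show ?thesis using assms(2,3) by (auto simp: mod_hom_def)
qed

text \<open>On finite sets the linear extension is the matrix map of the 0-1 incidence matrix of
  \<open>s\<close>, whence its linearity.\<close>

lemma free_map_mod_hom:
  assumes "finite E"
  shows "free_map R E E' s \<in> mod_hom R (fun_module R E) (fun_module R E')"
proof -
  have "free_map R E E' s u = matrix_map E E' (\<lambda>d e. of_bool (s e = d)) u"
    if "u \<in> E \<rightarrow>\<^sub>E carrier R" for u
  proof (rule PiE_ext[of _ E' "\<lambda>_. carrier R"])
    have u: "u \<in> E \<rightarrow> carrier R" using that by auto
    show "free_map R E E' s u \<in> E' \<rightarrow>\<^sub>E carrier R" by (rule free_map_closed[OF assms u])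
    show "matrix_map E E' (\<lambda>d e. of_bool (s e = d)) u \<in> E' \<rightarrow>\<^sub>E carrier R"
      by (rule matrix_map_closed[OF that])
    fix d assume d: "d \<in> E'"
    have "(\<Oplus>e\<in>E. if s e = d then u e else \<zero>) = (\<Oplus>e\<in>E. u e \<otimes> int_elem R (of_bool (s e = d)))"
      using u by (intro finsum_cong') (auto simp: Pi_iff)
    then show "free_map R E E' s u d = matrix_map E E' (\<lambda>d e. of_bool (s e = d)) u d"
      using d by (simp add: free_map_apply[OF assms u d] matrix_map_def)
  qed
  then show ?thesis
    by (intro mod_hom_cong[OF module_fun_module matrix_map_mod_hom[OF assms]])
       (simp add: fun_module_simps)
qed

end

section \<open>Inverses of linear bijections and of natural transformations\<close>

lemma inv_into_mod_hom:
  assumes "module k M" and h: "h \<in> mod_hom k M N" "bij_betw h (carrier M) (carrier N)"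
  shows "inv_into (carrier M) h \<in> mod_hom k N M"
proof -
  interpret module k M by (rule assms(1))
  let ?g = "inv_into (carrier M) h"
  have g: "?g w \<in> carrier M" "h (?g w) = w" if "w \<in> carrier N" for w
    using h(2) that by (auto simp: bij_betw_def inv_into_into f_inv_into_f)
  have gh: "?g (h u) = u" if "u \<in> carrier M" for u
    using h(2) that by (simp add: bij_betw_def)
  have "?g (w \<oplus>\<^bsub>N\<^esub> w') = ?g w \<oplus>\<^bsub>M\<^esub> ?g w'" if "w \<in> carrier N" "w' \<in> carrier N" for w w'
  proof -
    have "h (?g w \<oplus>\<^bsub>M\<^esub> ?g w') = w \<oplus>\<^bsub>N\<^esub> w'" using h(1) g that by (simp add: mod_hom_def)
    then show ?thesis using gh[of "?g w \<oplus>\<^bsub>M\<^esub> ?g w'"] g that by simp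
  qed
  moreover have "?g (c \<odot>\<^bsub>N\<^esub> w) = c \<odot>\<^bsub>M\<^esub> ?g w" if "c \<in> carrier k" "w \<in> carrier N" for c w
  proof -
    have "h (c \<odot>\<^bsub>M\<^esub> ?g w) = c \<odot>\<^bsub>N\<^esub> w" using h(1) g that by (simp add: mod_hom_def)
    then show ?thesis using gh[of "c \<odot>\<^bsub>M\<^esub> ?g w"] g that by simp
  qed
  ultimately show ?thesis using g(1) by (auto simp: mod_hom_def)
qed

lemma isomorphic_functorsI:
  assumes F: "module_functor k C F" and G: "module_functor k C G"
    and \<eta>: "natural_transformation k C F G \<eta>"
    and bij: "\<And>x. x \<in> Ob C \<Longrightarrow> bij_betw (\<eta> x) (carrier (on_ob F x)) (carrier (on_ob G x))"
  shows "isomorphic_functors k C F G"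
proof -
  define \<theta> where "\<theta> = (\<lambda>x. inv_into (carrier (on_ob F x)) (\<eta> x))"
  have hom: "\<eta> x \<in> mod_hom k (on_ob F x) (on_ob G x)" if "x \<in> Ob C" for x
    using \<eta> that by (simp add: natural_transformation_def)
  have \<theta>: "\<theta> x w \<in> carrier (on_ob F x)" "\<eta> x (\<theta> x w) = w"
    if "x \<in> Ob C" "w \<in> carrier (on_ob G x)" for x w
    using bij[OF that(1)] that(2) by (auto simp: \<theta>_def bij_betw_def inv_into_into f_inv_into_f)
  have \<theta>\<eta>: "\<theta> x (\<eta> x u) = u" if "x \<in> Ob C" "u \<in> carrier (on_ob F x)" for x u
    using bij[OF that(1)] that(2) by (simp add: \<theta>_def bij_betw_def)
  have "natural_transformation k C G F \<theta>"
    unfolding natural_transformation_def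
  proof (intro conjI ballI)
    show "\<theta> x \<in> mod_hom k (on_ob G x) (on_ob F x)" if "x \<in> Ob C" for x
      unfolding \<theta>_def by (rule inv_into_mod_hom[OF module_functor.ob_module[OF F that] hom[OF that] bij[OF that]])
    fix x y f w assume *: "x \<in> Ob C" "y \<in> Ob C" "f \<in> Hom C x y" "w \<in> carrier (on_ob G x)"
    have "on_arr F f (\<theta> x w) \<in> carrier (on_ob F y)"
      using module_functor.arr_mod_hom[OF F *(3)] \<theta>(1)[OF *(1,4)] by (auto simp: mod_hom_def)
    moreover have "\<eta> y (on_arr F f (\<theta> x w)) = on_arr G f w"
      using \<eta> * \<theta>[OF *(1,4)] by (simp add: natural_transformation_def)
    ultimately show "\<theta> y (on_arr G f w) = on_arr F f (\<theta> x w)"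
      using \<theta>\<eta>[OF *(2)] by metis
  qed
  then show ?thesis
    unfolding isomorphic_functors_def using F G \<eta> \<theta>(2) \<theta>\<eta> by blast
qed

section \<open>The duality isomorphism\<close>

lemma HomD:
  assumes "f \<in> Hom C x y"
  shows "f \<in> Arr C" "Dom C f = x" "Cod C f = y"
  using assms by (simp_all add: Hom_def)

lemma (in category) Hom_objects:
  assumes "f \<in> Hom C x y"
  shows "x \<in> Ob C" "y \<in> Ob C"
  using assms Dom_closed Cod_closed by (auto simp: Hom_def)

text \<open>The setting for functoriality and naturality: finite values identify
  \<open>free_module\<close> with \<open>fun_module\<close>. Invertibility of the orders is added
  only for bijectivity.\<close>

locale finite_ab_functor = cring k + ab_functor C A
  for k :: "('k, 'r) ring_scheme" and C :: "('o, 'm, 'z) cat_scheme"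
    and A :: "('o, 'm, 'a monoid, 'a) concrete_functor" +
  assumes finite_ob: "x \<in> Ob C \<Longrightarrow> finite (carrier (on_ob A x))"
begin

lemma arr_closed: "\<lbrakk>f \<in> Hom C x y; v \<in> carrier (on_ob A x)\<rbrakk> \<Longrightarrow> on_arr A f v \<in> carrier (on_ob A y)"
  using arr_hom by (auto simp: hom_def)

lemma on_ob_free_functor:
  "x \<in> Ob C \<Longrightarrow> on_ob (free_functor k C A) x = fun_module k (carrier (on_ob A x))"
  by (simp add: free_functor_def free_module_eq_fun_module finite_ob)

lemma on_arr_free_functor:
  "f \<in> Hom C x y \<Longrightarrow> on_arr (free_functor k C A) f =
    free_map k (carrier (on_ob A x)) (carrier (on_ob A y)) (on_arr A f)"
  by (simp add: free_functor_def HomD)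

lemma module_functor_free: "module_functor k C (free_functor k C A)"
proof (intro module_functor.intro module_functor_axioms.intro)
  show "category C" by (rule category_axioms)
next
  show "module k (on_ob (free_functor k C A) x)" if "x \<in> Ob C" for x
    using that by (simp add: on_ob_free_functor module_fun_module)
next
  fix f x y assume f: "f \<in> Hom C x y"
  then show "on_arr (free_functor k C A) f \<in> mod_hom k (on_ob (free_functor k C A) x) (on_ob (free_functor k C A) y)"
    using Hom_objects[OF f] by (simp add: on_ob_free_functor on_arr_free_functor free_map_mod_hom finite_ob)
next
  fix x u assume x: "x \<in> Ob C" and u: "u \<in> carrier (on_ob (free_functor k C A) x)"
  let ?E = "carrier (on_ob A x)"
  have u': "u \<in> ?E \<rightarrow>\<^sub>E carrier k" using u x by (simp add: on_ob_free_functor fun_module_simps)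
  then have u'': "u \<in> ?E \<rightarrow> carrier k" by auto
  have "free_map k ?E ?E (on_arr A (Ident C x)) u = u"
  proof (rule PiE_ext[of _ ?E "\<lambda>_. carrier k"])
    fix d assume d: "d \<in> ?E"
    have "free_map k ?E ?E (on_arr A (Ident C x)) u d =
        (\<Oplus>\<^bsub>k\<^esub>e\<in>?E. if on_arr A (Ident C x) e = d then u e else \<zero>\<^bsub>k\<^esub>)"
      by (rule free_map_apply[OF finite_ob[OF x] u'' d])
    also have "\<dots> = (\<Oplus>\<^bsub>k\<^esub>e\<in>?E. if e = d then u e else \<zero>\<^bsub>k\<^esub>)"
      using u'' x by (intro finsum_cong') (auto simp: arr_Ident)
    also have "\<dots> = u d" by (rule finsum_delta(1)[OF finite_ob[OF x] d u''])
    finally show "free_map k ?E ?E (on_arr A (Ident C x)) u d = u d" .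
  qed (rule free_map_closed[OF finite_ob[OF x] u''] u')+
  then show "on_arr (free_functor k C A) (Ident C x) u = u"
    using on_arr_free_functor[OF Ident_closed[OF x]] by simp
next
  fix f g x y z u assume f: "f \<in> Hom C x y" and g: "g \<in> Hom C y z"
    and u: "u \<in> carrier (on_ob (free_functor k C A) x)"
  note ob = Hom_objects[OF f] Hom_objects(2)[OF g]
  let ?X = "carrier (on_ob A x)" and ?Y = "carrier (on_ob A y)" and ?Z = "carrier (on_ob A z)"
  let ?f = "on_arr A f" and ?g = "on_arr A g" and ?gf = "on_arr A (Comp C g f)"
  have u': "u \<in> ?X \<rightarrow> carrier k" using u ob by (auto simp: on_ob_free_functor fun_module_simps)
  have fu: "free_map k ?X ?Y ?f u \<in> ?Y \<rightarrow>\<^sub>E carrier k"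
    by (rule free_map_closed[OF finite_ob[OF ob(1)] u'])
  then have fu': "free_map k ?X ?Y ?f u \<in> ?Y \<rightarrow> carrier k" by auto
  have f_mem: "?f \<in> ?X \<rightarrow> ?Y" using arr_closed[OF f] by auto
  have "free_map k ?X ?Z ?gf u = free_map k ?Y ?Z ?g (free_map k ?X ?Y ?f u)"
  proof (rule PiE_ext[of _ ?Z "\<lambda>_. carrier k"])
    fix d assume d: "d \<in> ?Z"
    \<comment> \<open>Weighting with the indicator of the fibre of g over d brings the sum into the
      form of \<open>finsum_free_map\<close>.\<close>
    let ?c = "\<lambda>w. if ?g w = d then \<one>\<^bsub>k\<^esub> else \<zero>\<^bsub>k\<^esub>"
    have "free_map k ?Y ?Z ?g (free_map k ?X ?Y ?f u) d =
        (\<Oplus>\<^bsub>k\<^esub>w\<in>?Y. if ?g w = d then free_map k ?X ?Y ?f u w else \<zero>\<^bsub>k\<^esub>)"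
      by (rule free_map_apply[OF finite_ob[OF ob(2)] fu' d])
    also have "\<dots> = (\<Oplus>\<^bsub>k\<^esub>w\<in>?Y. free_map k ?X ?Y ?f u w \<otimes>\<^bsub>k\<^esub> ?c w)"
      using fu' by (intro finsum_cong') (auto simp: Pi_iff)
    also have "\<dots> = (\<Oplus>\<^bsub>k\<^esub>v\<in>?X. u v \<otimes>\<^bsub>k\<^esub> ?c (?f v))"
      using finite_ob ob f_mem u' by (intro finsum_free_map) auto
    also have "\<dots> = (\<Oplus>\<^bsub>k\<^esub>v\<in>?X. if ?gf v = d then u v else \<zero>\<^bsub>k\<^esub>)"
      using u' arr_Comp[OF f g] by (intro finsum_cong') (auto simp: Pi_iff)
    also have "\<dots> = free_map k ?X ?Z ?gf u d"
      by (rule free_map_apply[OF finite_ob[OF ob(1)] u' d, symmetric])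
    finally show "free_map k ?X ?Z ?gf u d = free_map k ?Y ?Z ?g (free_map k ?X ?Y ?f u) d" ..
  qed (rule free_map_closed[OF finite_ob[OF ob(1)] u'] free_map_closed[OF finite_ob[OF ob(2)] fu'])+
  then show "on_arr (free_functor k C A) (Comp C g f) u =
      on_arr (free_functor k C A) g (on_arr (free_functor k C A) f u)"
    using on_arr_free_functor[OF Comp_closed[OF f g]] on_arr_free_functor[OF f] on_arr_free_functor[OF g]
    by simp
qed

abbreviation "dual_carrier x \<equiv> carrier (dual_group (on_ob A x))"

lemma on_arr_dual_functor:
  assumes "f \<in> Hom C x y"
  shows "on_arr (dual_functor C A) f \<phi> = (\<lambda>v\<in>carrier (on_ob A x). \<phi> (on_arr A f v))"
  using assms by (simp add: dual_functor_def HomD)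

lemma on_arr_dual_functor_closed:
  assumes f: "f \<in> Hom C x y" and \<phi>: "\<phi> \<in> dual_carrier y"
  shows "on_arr (dual_functor C A) f \<phi> \<in> dual_carrier x"
proof -
  interpret X: comm_group "on_ob A x" by (rule ob_comm_group[OF Hom_objects(1)[OF f]])
  show ?thesis
    using \<phi> arr_hom[OF f] unfolding on_arr_dual_functor[OF f] dual_group_simps
    by (auto simp: hom_def Pi_iff)
qed

lemma on_ob_fun_functor:
  "on_ob (fun_functor k C (dual_functor C A)) x = fun_module k (dual_carrier x)"
  by (simp add: fun_functor_def dual_functor_def)

lemma on_arr_fun_functor:
  "f \<in> Hom C x y \<Longrightarrow> on_arr (fun_functor k C (dual_functor C A)) f w =
    (\<lambda>\<phi>\<in>dual_carrier y. w (on_arr (dual_functor C A) f \<phi>))"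
  by (simp add: fun_functor_def HomD) (simp add: dual_functor_def)

lemma module_functor_fun_dual: "module_functor k C (fun_functor k C (dual_functor C A))"
proof (intro module_functor.intro module_functor_axioms.intro)
  show "category C" by (rule category_axioms)
next
  show "module k (on_ob (fun_functor k C (dual_functor C A)) x)" for x
    by (simp add: on_ob_fun_functor module_fun_module)
next
  fix f x y assume f: "f \<in> Hom C x y"
  show "on_arr (fun_functor k C (dual_functor C A)) f \<in>
      mod_hom k (on_ob (fun_functor k C (dual_functor C A)) x) (on_ob (fun_functor k C (dual_functor C A)) y)"
    using on_arr_dual_functor_closed[OF f]
    by (auto simp: mod_hom_def on_ob_fun_functor on_arr_fun_functor[OF f] fun_module_simps fun_eq_iff)
next
  fix x w assume x: "x \<in> Ob C" and w: "w \<in> carrier (on_ob (fun_functor k C (dual_functor C A)) x)"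
  have "on_arr (dual_functor C A) (Ident C x) \<phi> = \<phi>" if "\<phi> \<in> dual_carrier x" for \<phi>
    using that x unfolding on_arr_dual_functor[OF Ident_closed[OF x]]
    by (auto simp: dual_group_simps arr_Ident fun_eq_iff extensional_def)
  then have "on_arr (fun_functor k C (dual_functor C A)) (Ident C x) w = restrict w (dual_carrier x)"
    unfolding on_arr_fun_functor[OF Ident_closed[OF x]] by (intro restrict_ext) simp
  also have "\<dots> = w"
    using w unfolding on_ob_fun_functor fun_module_simps by (rule PiE_restrict)
  finally show "on_arr (fun_functor k C (dual_functor C A)) (Ident C x) w = w" .
next
  fix f g x y z w assume f: "f \<in> Hom C x y" and g: "g \<in> Hom C y z"
  have "on_arr (dual_functor C A) (Comp C g f) \<phi> =
      on_arr (dual_functor C A) f (on_arr (dual_functor C A) g \<phi>)" for \<phi>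
    unfolding on_arr_dual_functor[OF f] on_arr_dual_functor[OF g]
      on_arr_dual_functor[OF Comp_closed[OF f g]]
    using arr_closed[OF f] arr_Comp[OF f g] by (auto simp: fun_eq_iff)
  then show "on_arr (fun_functor k C (dual_functor C A)) (Comp C g f) w =
      on_arr (fun_functor k C (dual_functor C A)) g (on_arr (fun_functor k C (dual_functor C A)) f w)"
    unfolding on_arr_fun_functor[OF f] on_arr_fun_functor[OF g] on_arr_fun_functor[OF Comp_closed[OF f g]]
    using on_arr_dual_functor_closed[OF g] by (intro restrict_ext) simp
qed

definition duality_map :: "'o \<Rightarrow> ('a \<Rightarrow> 'k) \<Rightarrow> ('a \<Rightarrow> rat set) \<Rightarrow> 'k"
  where "duality_map x =
    matrix_map (carrier (on_ob A x)) (dual_carrier x) (\<lambda>\<phi> v. class_kernel (\<phi> v))"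

text \<open>Both composites send u to \<phi> \<mapsto> \<Sum> u(v) g(\<phi>(f v)), because the
  kernel sees only \<phi>(f v), which is the value at v of the pullback of \<phi>.\<close>

lemma natural_transformation_duality_map:
  "natural_transformation k C (free_functor k C A) (fun_functor k C (dual_functor C A)) duality_map"
  unfolding natural_transformation_def
proof (intro conjI ballI)
  show "duality_map x \<in> mod_hom k (on_ob (free_functor k C A) x) (on_ob (fun_functor k C (dual_functor C A)) x)"
    if "x \<in> Ob C" for x
    using that by (simp add: duality_map_def on_ob_free_functor on_ob_fun_functor matrix_map_mod_hom finite_ob)
  fix x y f u assume ob: "x \<in> Ob C" "y \<in> Ob C" and f: "f \<in> Hom C x y"
    and u: "u \<in> carrier (on_ob (free_functor k C A) x)"
  let ?X = "carrier (on_ob A x)" and ?Y = "carrier (on_ob A y)"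
  have u': "u \<in> ?X \<rightarrow> carrier k" using u ob by (auto simp: on_ob_free_functor fun_module_simps)
  have "duality_map y (free_map k ?X ?Y (on_arr A f) u) \<phi> =
      duality_map x u (on_arr (dual_functor C A) f \<phi>)" if \<phi>: "\<phi> \<in> dual_carrier y" for \<phi>
  proof -
    have "duality_map y (free_map k ?X ?Y (on_arr A f) u) \<phi> =
        (\<Oplus>\<^bsub>k\<^esub>w\<in>?Y. free_map k ?X ?Y (on_arr A f) u w \<otimes>\<^bsub>k\<^esub> int_elem k (class_kernel (\<phi> w)))"
      using \<phi> by (simp add: duality_map_def matrix_map_def)
    also have "\<dots> = (\<Oplus>\<^bsub>k\<^esub>v\<in>?X. u v \<otimes>\<^bsub>k\<^esub> int_elem k (class_kernel (\<phi> (on_arr A f v))))"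
      using finite_ob ob arr_closed[OF f] u' by (intro finsum_free_map) auto
    also have "\<dots> = (\<Oplus>\<^bsub>k\<^esub>v\<in>?X. u v \<otimes>\<^bsub>k\<^esub> int_elem k (class_kernel (on_arr (dual_functor C A) f \<phi> v)))"
      using u' by (intro finsum_cong') (auto simp: on_arr_dual_functor[OF f])
    also have "\<dots> = duality_map x u (on_arr (dual_functor C A) f \<phi>)"
      using on_arr_dual_functor_closed[OF f \<phi>] by (simp add: duality_map_def matrix_map_def)
    finally show ?thesis .
  qed
  then show "duality_map y (on_arr (free_functor k C A) f u) =
      on_arr (fun_functor k C (dual_functor C A)) f (duality_map x u)"
    unfolding on_arr_free_functor[OF f] on_arr_fun_functor[OF f]
    by (auto simp: fun_eq_iff duality_map_def matrix_map_def)
qed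

lemma bij_betw_duality_map:
  assumes x: "x \<in> Ob C" and unit: "int_elem k (int (order (on_ob A x))) \<in> Units k"
  shows "bij_betw (duality_map x) (carrier (on_ob (free_functor k C A) x))
    (carrier (on_ob (fun_functor k C (dual_functor C A)) x))"
proof -
  let ?V = "on_ob A x" and ?W = "dual_group (on_ob A x)"
  define n where "n = order ?V"
  note V = ob_comm_group[OF x] finite_ob[OF x]
  interpret P: residue_pairing ?W ?V n "dual_residue n"
    by (rule residue_pairing_dual_group[OF V n_def])
  interpret Q: residue_pairing ?V ?W n "\<lambda>v \<phi>. dual_residue n \<phi> v"
    by (rule P.flip)
  have K: "class_kernel (\<phi> v) = duality_kernel (of_int (dual_residue n \<phi> v) / of_nat n)"
    if "\<phi> \<in> carrier ?W" "v \<in> carrier ?V" for \<phi> v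
    by (subst rat_class_dual_residue[OF V n_def that]) (rule class_kernel_rat_class)
  have units: "int_elem k (int n ^ r) \<in> Units k" for r
    using int_elem_Units_power[OF unit] by (simp add: n_def)
  have 1: "\<exists>m a. int_elem k m \<in> Units k \<and>
      (\<forall>v\<in>carrier ?V. m * of_bool (v = t) = (\<Sum>\<phi>\<in>carrier ?W. a \<phi> * class_kernel (\<phi> v)))"
    if t: "t \<in> carrier ?V" for t
  proof -
    \<comment> \<open>The flipped pairing has the dual as its second group, so its span lemma
      requires n to be the order of the dual. It produces combinations of rows, hence injectivity;
      the original pairing produces combinations of columns, hence surjectivity.\<close>
    have "n = order ?W" unfolding n_def by (rule P.order_eq[symmetric])
    from Q.duality_kernel_matrix_span[OF this t] obtain r a where
      span: "\<forall>v\<in>carrier ?V. int n ^ r * of_bool (v = t) =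
        (\<Sum>\<phi>\<in>carrier ?W. a \<phi> * duality_kernel (of_int (dual_residue n \<phi> v) / of_nat n))" by blast
    have "int n ^ r * of_bool (v = t) = (\<Sum>\<phi>\<in>carrier ?W. a \<phi> * class_kernel (\<phi> v))"
      if "v \<in> carrier ?V" for v
      unfolding span[rule_format, OF that] using that by (intro sum.cong) (simp_all add: K)
    then show ?thesis
      by (intro exI[of _ "int n ^ r"] exI[of _ a] conjI ballI units)
  qed
  have 2: "\<exists>m a. int_elem k m \<in> Units k \<and>
      (\<forall>\<phi>\<in>carrier ?W. m * of_bool (\<phi> = t) = (\<Sum>v\<in>carrier ?V. a v * class_kernel (\<phi> v)))"
    if t: "t \<in> carrier ?W" for t
  proof -
    from P.duality_kernel_matrix_span[OF n_def t] obtain r a where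
      span: "\<forall>\<phi>\<in>carrier ?W. int n ^ r * of_bool (\<phi> = t) =
        (\<Sum>v\<in>carrier ?V. a v * duality_kernel (of_int (dual_residue n \<phi> v) / of_nat n))" by blast
    have "int n ^ r * of_bool (\<phi> = t) = (\<Sum>v\<in>carrier ?V. a v * class_kernel (\<phi> v))"
      if "\<phi> \<in> carrier ?W" for \<phi>
      unfolding span[rule_format, OF that] using that by (intro sum.cong) (simp_all add: K)
    then show ?thesis
      by (intro exI[of _ "int n ^ r"] exI[of _ a] conjI ballI units)
  qed
  show ?thesis
    unfolding bij_betw_def duality_map_def on_ob_free_functor[OF x] on_ob_fun_functor fun_module_simps
  proof (intro conjI equalityI subsetI)
    show "inj_on (matrix_map (carrier ?V) (carrier ?W) (\<lambda>\<phi> v. class_kernel (\<phi> v)))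
        (carrier ?V \<rightarrow>\<^sub>E carrier k)"
      by (rule matrix_map_inj[OF P.finite_right P.finite_left 1])
  next
    fix w assume "w \<in> matrix_map (carrier ?V) (carrier ?W) (\<lambda>\<phi> v. class_kernel (\<phi> v)) `
        (carrier ?V \<rightarrow>\<^sub>E carrier k)"
    then show "w \<in> carrier ?W \<rightarrow>\<^sub>E carrier k" by (rule imageE) (simp only: matrix_map_closed)
  next
    fix w assume w: "w \<in> carrier ?W \<rightarrow>\<^sub>E carrier k"
    show "w \<in> matrix_map (carrier ?V) (carrier ?W) (\<lambda>\<phi> v. class_kernel (\<phi> v)) `
        (carrier ?V \<rightarrow>\<^sub>E carrier k)"
      by (rule matrix_map_surj[OF P.finite_right P.finite_left 2 w])
  qed
qed

end

theorem mainTheorem1: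
  fixes k :: "('k, 'r) ring_scheme"
    and C :: "('o, 'm, 'z) preadd_cat_scheme"
    and A :: "('o, 'm, 'a monoid, 'a) concrete_functor"
  assumes "cring k" and "\<one>\<^bsub>k\<^esub> \<noteq> \<zero>\<^bsub>k\<^esub>"
    and "additive_category C"
    and "additive_functor C A"
    and "k_trivial k C A"
  shows "isomorphic_functors k C (free_functor k C A) (fun_functor k C (dual_functor C A))"
proof -
  interpret k: cring k by (rule assms(1))
  interpret A: additive_functor C A by (rule assms(4))
  interpret finite_ab_functor k C A
    using assms(5) by unfold_locales (simp add: k_trivial_def)
  show ?thesis
  proof (rule isomorphic_functorsI[OF module_functor_free module_functor_fun_dual
        natural_transformation_duality_map])
    fix x assume x: "x \<in> Ob C"
    \<comment> \<open>The vanishing of the tensor product enters here, as invertibility of the order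
      of A(x) in k.\<close>
    have "int_elem k (int (order (on_ob A x))) \<in> Units k"
      using assms(5) x
      by (intro k.trivial_tensor_imp_order_Units A.ob_comm_group finite_ob) (simp_all add: k_trivial_def)
    then show "bij_betw (duality_map x) (carrier (on_ob (free_functor k C A) x))
        (carrier (on_ob (fun_functor k C (dual_functor C A)) x))"
      by (rule bij_betw_duality_map[OF x])
  qed
qed

end
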